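(* Let $\mathcal{S}$ be a schema and let $\Sigma=\langle\Gamma_O,\Gamma_V,\Delta\rangle$ be an ER specification over $\mathcal{S}$. Let $\mathcal{S}_{\mathsf{V}}$ be the schema obtained from $\mathcal{S}$ by changing every object position into a value position, and for an $\mathcal{S}$-database $D$ let $D^{\mathsf{V}}$ denote the same set of facts viewed as an $\mathcal{S}_{\mathsf{V}}$-database (all object constants of $D$ are treated as value constants; in particular $\mathsf{Obj}(D^{\mathsf{V}})=\emptyset$ and $\mathsf{Cells}(D^{\mathsf{V}})$ contains all positions $\langle t,i\rangle$ with $i\ge 1$). Then there exists an ER specification $\Sigma'=\langle\emptyset,\Gamma_V',\Delta\rangle$ over $\mathcal{S}_{\mathsf{V}}$ (having no rules for objects and the same denial constraints $\Delta$) such that for every $\mathcal{S}$-database $D$: $$\mathsf{Sol}(D^{\mathsf{V}},\Sigma')=\{\langle\emptyset,\,V\cup V_E\rangle \mid \langle E,V\rangle\in\mathsf{Sol}(D,\Sigma)\},$$ where $V_E$ is the set of all pairs $(\langle t,i\rangle,\langle t',j\rangle)$ of positions of $D$ such that $(t[i],t'[j])\in E$.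
   Context: Constants come from three pairwise disjoint infinite sets: objects $\mathsf{O}$, values $\mathsf{V}$, and tuple identifiers (tids) $\mathsf{TID}$. A schema $\mathcal{S}$ is a finite set of relation symbols $R$, each with an arity $k$ and a type vector in $\{\mathsf{O},\mathsf{V}\}^k$; position $i$ of $R$ is an object (resp. value) position if $\mathbf{type}(R,i)=\mathsf{O}$ (resp. $\mathsf{V}$). An $\mathcal{S}$-database $D$ is a finite set of facts $R(t,c_1,\dots,c_k)$ with $R/k\in\mathcal{S}$, $t\in\mathsf{TID}$, $c_i\in\mathbf{type}(R,i)$, each tid occurring in at most one fact; $t[i]$ is the constant at position $i$ of the fact with tid $t$. $\mathsf{Obj}(D)$ is the set of objects occurring in $D$, $\mathsf{Dom}(D)$ the set of constants occurring in $D$, and $\mathsf{Cells}(D)=\{\langle t,i\rangle\mid R(t,c_1,\dots,c_k)\in D,\ \mathbf{type}(R,i)=\mathsf{V}\}$. A conjunctive query (CQ) $q(\vec x)=\exists\vec y.\varphi(\vec x,\vec y)$ has $\varphi$ a conjunction of relational atoms $R(u_0,u_1,\dots,u_k)$ ($u_0$ in the tid position, terms are constants or variables); extended CQs may also contain inequality atoms $z\neq z'$ and atoms $u\approx u'$ of binary similarity predicates with a fixed interpretation over constants (these never use the tid position). A denial constraint has the form $\exists\vec y.\varphi(\vec y)\to\bot$ with $\varphi$ a Boolean CQ possibly with inequalities, every variable of an inequality occurring in a relational atom. $\mathsf{EqRel}(P,S)$ is the smallest equivalence relation on $S$ containing $P$. Induced database: for an equivalence relation $E$ on $\mathsf{Obj}(D)$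 and $V$ on $\mathsf{Cells}(D)$, $D_{E,V}$ is obtained from $D$ by replacing each tid $t$ by $\{t\}$, each occurrence of an object $o$ by $\{o'\mid(o,o')\in E\}$, and the value in each cell $\langle t,i\rangle$ by $\{t'[i']\mid(\langle t,i\rangle,\langle t',i'\rangle)\in V\}$. A Boolean (extended) query $q$ is satisfied in $D_{E,V}$ if there are $h:\mathrm{vars}(q)\cup\mathrm{cons}(q)\to 2^{\mathsf{Dom}(D)}\setminus\{\emptyset\}$ and, for each $k$-ary relational atom $\pi$ of $q$, $g_\pi:\{0,\dots,k\}\to 2^{\mathsf{Dom}(D)}$ such that: (1) $h(a)=\{a\}$ for constants $a$, and for each variable $z$, $h(z)$ is the intersection of all $g_\pi(i)$ with $z$ the $i$-th argument of $\pi$; (2) for each relational atom $\pi=R(u_0,\dots,u_k)$, $R(g_\pi(0),\dots,g_\pi(k))\in D_{E,V}$, and $u_i\in g_\pi(i)$ whenever $u_i$ is a constant; (3) for each $z\neq z'$, $h(z)\cap h(z')=\emptyset$; (4) for each $u\approx u'$, some $c\in h(u)$, $c'\in h(u')$ satisfy $c\approx c'$. The answers $q(D_{E,V})$ of $q(\vec x)$ are the tuples $\vec c$ with $D_{E,V}\models q[\vec c]$. Rules: a hard (resp. soft) rule for objects is $q(x,y)\Rightarrow\mathsf{EqO}(x,y)$ (resp. $q(x,y)\dashrightarrow\mathsf{EqO}(x,y)$), $q$ a CQ possibly with similarity atoms, $x,y$ occurring only in object positions. A hard (resp. soft) rule for values is $q(x_t,y_t)\Rightarrow\mathsf{EqV}(\langle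 x_t,i\rangle,\langle y_t,j\rangle)$ (resp. with $\dashrightarrow$), $q$ a CQ possibly with similarity atoms, $x_t,y_t$ each occurring once in $q$, in position 0 of relational atoms over $R_x,R_y$, with $i,j$ value positions of $R_x,R_y$. An ER specification is $\Sigma=\langle\Gamma_O,\Gamma_V,\Delta\rangle$ with $\Gamma_O=\Gamma^o_h\cup\Gamma^o_s$ a finite set of hard and soft rules for objects, $\Gamma_V=\Gamma^v_h\cup\Gamma^v_s$ a finite set of hard and soft rules for values, $\Delta$ a finite set of denial constraints. $D_{E,V}$ satisfies a denial constraint iff it does not satisfy its body; it satisfies an object rule iff $q(D_{E,V})\subseteq E$; it satisfies a value rule iff $(t_1,t_2)\in q(D_{E,V})$ implies $(\langle t_1,i\rangle,\langle t_2,j\rangle)\in V$. Candidate solutions for $(D,\Sigma)$ are defined inductively: $\langle\mathsf{EqRel}(\emptyset,\mathsf{Obj}(D)),\mathsf{EqRel}(\emptyset,\mathsf{Cells}(D))\rangle$ is one; if $\langle E',V\rangle$ is one and $(o,o')\in q(D_{E',V})$ for some rule $q(x,y)\to\mathsf{EqO}(x,y)\in\Gamma_O$ (hard or soft), then $\langle\mathsf{EqRel}(E'\cup\{(o,o')\},\mathsf{Obj}(D)),V\rangle$ is one; if $\langle E,V'\rangle$ is one and $(t,t')\in q(D_{E,V'})$ for some rule $q(x_t,y_t)\to\mathsf{EqV}(\langle x_t,i\rangle,\langle y_t,i'\rangle)\in\Gamma_V$, then $\langle E,\mathsf{EqRel}(V'\cup\{(\langle t,i\rangle,\langle t',i'\rangle)\},\mathsf{Cells}(D))\rangle$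 is one. A solution is a candidate solution $\langle E,V\rangle$ with $D_{E,V}$ satisfying $\Gamma^o_h\cup\Gamma^v_h\cup\Delta$; $\mathsf{Sol}(D,\Sigma)$ is the set of solutions. *)

theory Defs
  imports Main
begin

section \<open>Schemas and databases\<close>

datatype ('o, 'v, 't) const = Obj 'o | Val 'v | Tid 't

datatype ctype = OType | VType

text \<open>
  A schema maps each of its relation symbols to its type vector, whose length is the arity.
  Facts and atoms carry the tid at list index 0, so that index \<open>i \<ge> 1\<close> is position \<open>i\<close>.
\<close>

type_synonym 'r schema = "'r \<Rightarrow> ctype list option"

type_synonym ('r, 'o, 'v, 't) fact = "'r \<times> ('o, 'v, 't) const list"

type_synonym ('o, 'v, 't) cell = "('o, 'v, 't) const \<times> nat"

definition obj_pos :: "'r schema \<Rightarrow> 'r \<Rightarrow> nat \<Rightarrow> bool" where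
  "obj_pos S R i \<longleftrightarrow> (\<exists>ts. S R = Some ts \<and> 1 \<le> i \<and> i \<le> length ts \<and> ts ! (i - 1) = OType)"

definition val_pos :: "'r schema \<Rightarrow> 'r \<Rightarrow> nat \<Rightarrow> bool" where
  "val_pos S R i \<longleftrightarrow> (\<exists>ts. S R = Some ts \<and> 1 \<le> i \<and> i \<le> length ts \<and> ts ! (i - 1) = VType)"

text \<open>The set of constants denoted by each type is a parameter, because the all-value schema
  is used with the objects counted among the value constants.\<close>

definition std_carrier :: "ctype \<Rightarrow> ('o, 'v, 't) const set" where
  "std_carrier \<tau> = (case \<tau> of OType \<Rightarrow> range Obj | VType \<Rightarrow> range Val)"

definition value_carrier :: "ctype \<Rightarrow> ('o, 'v, 't) const set" where
  "value_carrier \<tau> = (case \<tau> of OType \<Rightarrow> {} | VType \<Rightarrow> range Obj \<union> range Val)"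

definition database ::
  "(ctype \<Rightarrow> ('o, 'v, 't) const set) \<Rightarrow> 'r schema \<Rightarrow> ('r, 'o, 'v, 't) fact set \<Rightarrow> bool" where
  "database C S D \<longleftrightarrow>
     finite D \<and>
     (\<forall>(R, cs) \<in> D. \<exists>ts. S R = Some ts \<and> length cs = Suc (length ts) \<and> cs ! 0 \<in> range Tid \<and>
        (\<forall>i \<in> {1..length ts}. cs ! i \<in> C (ts ! (i - 1)))) \<and>
     (\<forall>(R, cs) \<in> D. \<forall>(R', cs') \<in> D. cs ! 0 = cs' ! 0 \<longrightarrow> (R, cs) = (R', cs'))"

definition Dom :: "('r, 'o, 'v, 't) fact set \<Rightarrow> ('o, 'v, 't) const set" where
  "Dom D = (\<Union>(R, cs) \<in> D. set cs)"

text \<open>Objects are the constants in object positions; see \<open>Objs_eq\<close> below.\<close>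

definition Objs :: "'r schema \<Rightarrow> ('r, 'o, 'v, 't) fact set \<Rightarrow> ('o, 'v, 't) const set" where
  "Objs S D = {cs ! i | R cs i. (R, cs) \<in> D \<and> obj_pos S R i}"

definition Cells :: "'r schema \<Rightarrow> ('r, 'o, 'v, 't) fact set \<Rightarrow> ('o, 'v, 't) cell set" where
  "Cells S D = {(cs ! 0, i) | R cs i. (R, cs) \<in> D \<and> val_pos S R i}"

definition Positions :: "('r, 'o, 'v, 't) fact set \<Rightarrow> ('o, 'v, 't) cell set" where
  "Positions D = {(cs ! 0, i) | R cs i. (R, cs) \<in> D \<and> 1 \<le> i \<and> i < length cs}"

text \<open>The constant \<open>t[i]\<close>.\<close>

definition const_at ::
  "('r, 'o, 'v, 't) fact set \<Rightarrow> ('o, 'v, 't) cell \<Rightarrow> ('o, 'v, 't) const" where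
  "const_at D p = (THE c. \<exists>R cs. (R, cs) \<in> D \<and> cs ! 0 = fst p \<and> snd p < length cs \<and> c = cs ! snd p)"

definition valued :: "'r schema \<Rightarrow> 'r schema" where
  "valued S = (\<lambda>R. map_option (map (\<lambda>_. VType)) (S R))"


section \<open>Queries\<close>

datatype ('o, 'v, 't) trm = Var nat | Const "('o, 'v, 't) const"

datatype ('r, 's, 'o, 'v, 't) query = Query
  (rels: "('r \<times> ('o, 'v, 't) trm list) list")
  (sims: "('s \<times> ('o, 'v, 't) trm \<times> ('o, 'v, 't) trm) list")
  (ineqs: "(('o, 'v, 't) trm \<times> ('o, 'v, 't) trm) list")

definition terms :: "('r, 's, 'o, 'v, 't) query \<Rightarrow> ('o, 'v, 't) trm set" where
  "terms q = (\<Union>(R, us) \<in> set (rels q). set us) \<union> (\<Union>(s, u, u') \<in> set (sims q). {u, u'})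
     \<union> (\<Union>(z, z') \<in> set (ineqs q). {z, z'})"

definition sim_terms :: "('r, 's, 'o, 'v, 't) query \<Rightarrow> ('o, 'v, 't) trm set" where
  "sim_terms q = (\<Union>(s, u, u') \<in> set (sims q). {u, u'})"

text \<open>Occurrences of a term in relational atoms, as pairs of atom index and position.\<close>

definition occs :: "('r, 's, 'o, 'v, 't) query \<Rightarrow> ('o, 'v, 't) trm \<Rightarrow> (nat \<times> nat) set" where
  "occs q u = {(n, i). n < length (rels q) \<and> i < length (snd (rels q ! n)) \<and> snd (rels q ! n) ! i = u}"

definition wf_query :: "'r schema \<Rightarrow> ('r, 's, 'o, 'v, 't) query \<Rightarrow> bool" where
  "wf_query S q \<longleftrightarrow> (\<forall>(R, us) \<in> set (rels q). \<exists>ts. S R = Some ts \<and> length us = Suc (length ts))"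

fun subst_trm ::
  "(nat \<Rightarrow> ('o, 'v, 't) const option) \<Rightarrow> ('o, 'v, 't) trm \<Rightarrow> ('o, 'v, 't) trm" where
  "subst_trm \<sigma> (Const c) = Const c"
| "subst_trm \<sigma> (Var x) = (case \<sigma> x of None \<Rightarrow> Var x | Some c \<Rightarrow> Const c)"

definition subst ::
  "(nat \<Rightarrow> ('o, 'v, 't) const option) \<Rightarrow> ('r, 's, 'o, 'v, 't) query \<Rightarrow> ('r, 's, 'o, 'v, 't) query" where
  "subst \<sigma> q = Query
     (map (\<lambda>(R, us). (R, map (subst_trm \<sigma>) us)) (rels q))
     (map (\<lambda>(s, u, u'). (s, subst_trm \<sigma> u, subst_trm \<sigma> u')) (sims q))
     (map (\<lambda>(z, z'). (subst_trm \<sigma> z, subst_trm \<sigma> z')) (ineqs q))"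


section \<open>Induced databases and query answering\<close>

definition induced_arg ::
  "'r schema \<Rightarrow> ('r, 'o, 'v, 't) fact set \<Rightarrow> ('o, 'v, 't) const rel \<Rightarrow> ('o, 'v, 't) cell rel
    \<Rightarrow> 'r \<Rightarrow> ('o, 'v, 't) const list \<Rightarrow> nat \<Rightarrow> ('o, 'v, 't) const set" where
  "induced_arg S D E V R cs i =
     (if i = 0 then {cs ! 0}
      else if obj_pos S R i then {o'. (cs ! i, o') \<in> E}
      else {const_at D p | p. ((cs ! 0, i), p) \<in> V})"

definition induced ::
  "'r schema \<Rightarrow> ('r, 'o, 'v, 't) fact set \<Rightarrow> ('o, 'v, 't) const rel \<Rightarrow> ('o, 'v, 't) cell rel
    \<Rightarrow> ('r \<times> ('o, 'v, 't) const set list) set" where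
  "induced S D E V = (\<lambda>(R, cs). (R, map (induced_arg S D E V R cs) [0..<length cs])) ` D"

text \<open>
  Satisfaction of a Boolean query, all of whose variables are read existentially. \<open>g n\<close> is the
  function for the \<open>n\<close>-th relational atom. Intersections are taken within \<open>Dom D\<close>, which only
  matters for a variable without occurrence in a relational atom.
\<close>

definition sat ::
  "('s \<Rightarrow> ('o, 'v, 't) const rel) \<Rightarrow> 'r schema \<Rightarrow> ('r, 'o, 'v, 't) fact set
    \<Rightarrow> ('o, 'v, 't) const rel \<Rightarrow> ('o, 'v, 't) cell rel \<Rightarrow> ('r, 's, 'o, 'v, 't) query \<Rightarrow> bool" where
  "sat sim S D E V q \<longleftrightarrow>
     (\<exists>(h :: ('o, 'v, 't) trm \<Rightarrow> ('o, 'v, 't) const set) (g :: nat \<Rightarrow> nat \<Rightarrow> ('o, 'v, 't) const set).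
        (\<forall>u \<in> terms q. h u \<subseteq> Dom D \<and> h u \<noteq> {}) \<and>
        (\<forall>n < length (rels q). \<forall>i < length (snd (rels q ! n)). g n i \<subseteq> Dom D \<and> g n i \<noteq> {}) \<and>
        (\<forall>a. Const a \<in> terms q \<longrightarrow> h (Const a) = {a}) \<and>
        (\<forall>z. Var z \<in> terms q \<longrightarrow> h (Var z) = Dom D \<inter> (\<Inter>(n, i) \<in> occs q (Var z). g n i)) \<and>
        (\<forall>n < length (rels q). case rels q ! n of (R, us) \<Rightarrow>
           (R, map (g n) [0..<length us]) \<in> induced S D E V \<and>
           (\<forall>i < length us. \<forall>a. us ! i = Const a \<longrightarrow> a \<in> g n i)) \<and>
        (\<forall>(z, z') \<in> set (ineqs q). h z \<inter> h z' = {}) \<and>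
        (\<forall>(s, u, u') \<in> set (sims q). \<exists>c \<in> h u. \<exists>c' \<in> h u'. (c, c') \<in> sim s))"

text \<open>Answers of a query with the two free variables \<open>x\<close> and \<open>y\<close>.\<close>

definition answers ::
  "('s \<Rightarrow> ('o, 'v, 't) const rel) \<Rightarrow> 'r schema \<Rightarrow> ('r, 'o, 'v, 't) fact set
    \<Rightarrow> ('o, 'v, 't) const rel \<Rightarrow> ('o, 'v, 't) cell rel
    \<Rightarrow> ('r, 's, 'o, 'v, 't) query \<Rightarrow> nat \<Rightarrow> nat \<Rightarrow> ('o, 'v, 't) const rel" where
  "answers sim S D E V q x y = {(c, c'). sat sim S D E V (subst [x \<mapsto> c, y \<mapsto> c'] q)}"


section \<open>Specifications\<close>

text \<open>\<open>ORule q x y\<close> is the rule from \<open>q(x,y)\<close> to \<open>EqO(x,y)\<close>, and \<open>VRule q x i y j\<close> the rule from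
  \<open>q(x,y)\<close> to \<open>EqV(\<langle>x,i\<rangle>,\<langle>y,j\<rangle>)\<close>. A denial constraint is given by its body.\<close>

datatype ('r, 's, 'o, 'v, 't) orule = ORule "('r, 's, 'o, 'v, 't) query" nat nat

datatype ('r, 's, 'o, 'v, 't) vrule = VRule "('r, 's, 'o, 'v, 't) query" nat nat nat nat

record ('r, 's, 'o, 'v, 't) spec =
  hard_o :: "('r, 's, 'o, 'v, 't) orule set"
  soft_o :: "('r, 's, 'o, 'v, 't) orule set"
  hard_v :: "('r, 's, 'o, 'v, 't) vrule set"
  soft_v :: "('r, 's, 'o, 'v, 't) vrule set"
  denials :: "('r, 's, 'o, 'v, 't) query set"

text \<open>The free variables of an object rule occur in object positions of relational atoms and
  nowhere else; in particular they do not occur in similarity atoms.\<close>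

definition only_obj_occs :: "'r schema \<Rightarrow> ('r, 's, 'o, 'v, 't) query \<Rightarrow> nat \<Rightarrow> bool" where
  "only_obj_occs S q x \<longleftrightarrow> occs q (Var x) \<noteq> {} \<and> Var x \<notin> sim_terms q \<and>
     (\<forall>(n, i) \<in> occs q (Var x). obj_pos S (fst (rels q ! n)) i)"

fun wf_orule :: "'r schema \<Rightarrow> ('r, 's, 'o, 'v, 't) orule \<Rightarrow> bool" where
  "wf_orule S (ORule q x y) \<longleftrightarrow> wf_query S q \<and> ineqs q = [] \<and> x \<noteq> y \<and>
     only_obj_occs S q x \<and> only_obj_occs S q y"

definition once_as_tid :: "'r schema \<Rightarrow> ('r, 's, 'o, 'v, 't) query \<Rightarrow> nat \<Rightarrow> nat \<Rightarrow> bool" where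
  "once_as_tid S q x i \<longleftrightarrow> Var x \<notin> sim_terms q \<and>
     (\<exists>n. occs q (Var x) = {(n, 0)} \<and> val_pos S (fst (rels q ! n)) i)"

fun wf_vrule :: "'r schema \<Rightarrow> ('r, 's, 'o, 'v, 't) vrule \<Rightarrow> bool" where
  "wf_vrule S (VRule q x i y j) \<longleftrightarrow> wf_query S q \<and> ineqs q = [] \<and> x \<noteq> y \<and>
     once_as_tid S q x i \<and> once_as_tid S q y j"

definition wf_denial :: "'r schema \<Rightarrow> ('r, 's, 'o, 'v, 't) query \<Rightarrow> bool" where
  "wf_denial S q \<longleftrightarrow> wf_query S q \<and> sims q = [] \<and>
     (\<forall>(u, u') \<in> set (ineqs q). \<exists>z z'. u = Var z \<and> u' = Var z' \<and>
        occs q (Var z) \<noteq> {} \<and> occs q (Var z') \<noteq> {})"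

definition er_spec :: "'r schema \<Rightarrow> ('r, 's, 'o, 'v, 't) spec \<Rightarrow> bool" where
  "er_spec S \<Sigma> \<longleftrightarrow>
     finite (hard_o \<Sigma>) \<and> finite (soft_o \<Sigma>) \<and> finite (hard_v \<Sigma>) \<and> finite (soft_v \<Sigma>) \<and>
     finite (denials \<Sigma>) \<and>
     (\<forall>r \<in> hard_o \<Sigma> \<union> soft_o \<Sigma>. wf_orule S r) \<and>
     (\<forall>r \<in> hard_v \<Sigma> \<union> soft_v \<Sigma>. wf_vrule S r) \<and>
     (\<forall>q \<in> denials \<Sigma>. wf_denial S q)"


section \<open>Solutions\<close>

text \<open>Meaningful for \<open>P \<subseteq> A \<times> A\<close> only, which is the case wherever it is used for well-formed
  specifications.\<close>

definition EqRel :: "'a rel \<Rightarrow> 'a set \<Rightarrow> 'a rel" where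
  "EqRel P A = \<Inter>{r. equiv A r \<and> P \<subseteq> r}"

inductive candidate ::
  "('s \<Rightarrow> ('o, 'v, 't) const rel) \<Rightarrow> 'r schema \<Rightarrow> ('r, 'o, 'v, 't) fact set
    \<Rightarrow> ('r, 's, 'o, 'v, 't) spec \<Rightarrow> ('o, 'v, 't) const rel \<Rightarrow> ('o, 'v, 't) cell rel \<Rightarrow> bool"
  for sim S D \<Sigma> where
  init: "candidate sim S D \<Sigma> (EqRel {} (Objs S D)) (EqRel {} (Cells S D))"
| obj: "candidate sim S D \<Sigma> E V \<Longrightarrow> ORule q x y \<in> hard_o \<Sigma> \<union> soft_o \<Sigma> \<Longrightarrow>
    (c, c') \<in> answers sim S D E V q x y \<Longrightarrow>
    candidate sim S D \<Sigma> (EqRel (E \<union> {(c, c')}) (Objs S D)) V"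
| val: "candidate sim S D \<Sigma> E V \<Longrightarrow> VRule q x i y j \<in> hard_v \<Sigma> \<union> soft_v \<Sigma> \<Longrightarrow>
    (t, t') \<in> answers sim S D E V q x y \<Longrightarrow>
    candidate sim S D \<Sigma> E (EqRel (V \<union> {((t, i), (t', j))}) (Cells S D))"

definition Sol ::
  "('s \<Rightarrow> ('o, 'v, 't) const rel) \<Rightarrow> 'r schema \<Rightarrow> ('r, 'o, 'v, 't) fact set
    \<Rightarrow> ('r, 's, 'o, 'v, 't) spec \<Rightarrow> (('o, 'v, 't) const rel \<times> ('o, 'v, 't) cell rel) set" where
  "Sol sim S D \<Sigma> = {(E, V). candidate sim S D \<Sigma> E V \<and>
     (\<forall>q x y. ORule q x y \<in> hard_o \<Sigma> \<longrightarrow> answers sim S D E V q x y \<subseteq> E) \<and>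
     (\<forall>q x i y j. VRule q x i y j \<in> hard_v \<Sigma> \<longrightarrow>
        (\<forall>(t, t') \<in> answers sim S D E V q x y. ((t, i), (t', j)) \<in> V)) \<and>
     (\<forall>q \<in> denials \<Sigma>. \<not> sat sim S D E V q)}"

text \<open>The relation \<open>V\<^sub>E\<close>.\<close>

definition pos_rel ::
  "('r, 'o, 'v, 't) fact set \<Rightarrow> ('o, 'v, 't) const rel \<Rightarrow> ('o, 'v, 't) cell rel" where
  "pos_rel D E = {(p, p'). p \<in> Positions D \<and> p' \<in> Positions D \<and> (const_at D p, const_at D p') \<in> E}"


section \<open>Basic facts\<close>

lemma database_entry:
  assumes "database C S D" "(R, cs) \<in> D"
  obtains ts where "S R = Some ts" "length cs = Suc (length ts)" "cs ! 0 \<in> range Tid"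
    "\<And>i. 1 \<le> i \<Longrightarrow> i \<le> length ts \<Longrightarrow> cs ! i \<in> C (ts ! (i - 1))"
  using assms unfolding database_def by fastforce

lemma Objs_eq:
  assumes db: "database std_carrier S D"
  shows "Objs S D = Dom D \<inter> range Obj"
proof (intro set_eqI iffI)
  fix c assume "c \<in> Objs S D"
  then obtain R cs i where *: "c = cs ! i" "(R, cs) \<in> D" "obj_pos S R i"
    unfolding Objs_def by blast
  obtain ts where ts: "S R = Some ts" "length cs = Suc (length ts)"
    "\<And>i. 1 \<le> i \<Longrightarrow> i \<le> length ts \<Longrightarrow> cs ! i \<in> std_carrier (ts ! (i - 1))"
    using database_entry[OF db *(2)] by metis
  then have i: "1 \<le> i" "i \<le> length ts" "ts ! (i - 1) = OType"
    using *(3) unfolding obj_pos_def by auto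
  have "c \<in> range Obj" using ts(3)[OF i(1,2)] i(3) *(1) by (simp add: std_carrier_def)
  moreover have "c \<in> set cs" using *(1) i ts(2) by simp
  ultimately show "c \<in> Dom D \<inter> range Obj" using *(2) unfolding Dom_def by blast
next
  fix c assume "c \<in> Dom D \<inter> range Obj"
  then obtain R cs a where *: "(R, cs) \<in> D" "c \<in> set cs" "c = Obj a"
    unfolding Dom_def by blast
  obtain i where i: "i < length cs" "c = cs ! i" using *(2) by (metis in_set_conv_nth)
  obtain ts where ts: "S R = Some ts" "length cs = Suc (length ts)" "cs ! 0 \<in> range Tid"
    "\<And>i. 1 \<le> i \<Longrightarrow> i \<le> length ts \<Longrightarrow> cs ! i \<in> std_carrier (ts ! (i - 1))"
    using database_entry[OF db *(1)] by metis
  have i1: "1 \<le> i" using ts(3) *(3) i(2) by (cases i) auto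
  have i2: "i \<le> length ts" using i ts(2) by simp
  have "ts ! (i - 1) = OType"
    using ts(4)[OF i1 i2] *(3) i(2) by (cases "ts ! (i - 1)") (auto simp: std_carrier_def)
  then have "obj_pos S R i" using ts(1) i1 i2 unfolding obj_pos_def by blast
  then show "c \<in> Objs S D" using * i unfolding Objs_def by blast
qed

lemma database_valued:
  assumes db: "database std_carrier S D"
  shows "database value_carrier (valued S) D"
proof -
  have "\<exists>ts. valued S R = Some ts \<and> length cs = Suc (length ts) \<and> cs ! 0 \<in> range Tid \<and>
      (\<forall>i \<in> {1..length ts}. cs ! i \<in> value_carrier (ts ! (i - 1)))" if m: "(R, cs) \<in> D" for R cs
  proof -
    obtain ts where ts: "S R = Some ts" "length cs = Suc (length ts)" "cs ! 0 \<in> range Tid"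
      "\<And>i. 1 \<le> i \<Longrightarrow> i \<le> length ts \<Longrightarrow> cs ! i \<in> std_carrier (ts ! (i - 1))"
      using database_entry[OF db m] by metis
    have "std_carrier \<tau> \<subseteq> value_carrier VType" for \<tau>
      by (cases \<tau>) (auto simp: std_carrier_def value_carrier_def)
    then have "cs ! i \<in> value_carrier VType" if "1 \<le> i" "i \<le> length ts" for i
      using ts(4)[OF that] by blast
    then show ?thesis using ts(1-3) by (auto simp: valued_def)
  qed
  then show ?thesis using db unfolding database_def by blast
qed

lemma Objs_valued: "Objs (valued S) D = {}"
  by (auto simp: Objs_def obj_pos_def valued_def)

lemma Cells_valued:
  assumes db: "database std_carrier S D"
  shows "Cells (valued S) D = Positions D"
proof -
  have "val_pos (valued S) R i \<longleftrightarrow> 1 \<le> i \<and> i < length cs" if "(R, cs) \<in> D" for R cs i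
    using database_entry[OF db that] by (fastforce simp: val_pos_def valued_def)
  then show ?thesis unfolding Cells_def Positions_def by blast
qed

lemma const_at_eq:
  assumes db: "database C S D" and "(R, cs) \<in> D" "i < length cs"
  shows "const_at D (cs ! 0, i) = cs ! i"
proof -
  have uniq: "(R', cs') = (R, cs)" if "(R', cs') \<in> D" "cs' ! 0 = cs ! 0" for R' cs'
    using db that assms(2) unfolding database_def by fast
  show ?thesis unfolding const_at_def
    by (rule the_equality) (use assms(2,3) uniq in auto)
qed

lemma equiv_EqRel:
  assumes "P \<subseteq> A \<times> A"
  shows "equiv A (EqRel P A)"
proof -
  have "equiv A (A \<times> A)" by (auto simp: equiv_def refl_on_def sym_def trans_def)
  then have "EqRel P A \<subseteq> A \<times> A" using assms unfolding EqRel_def by blast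
  moreover have "refl_on A (EqRel P A)"
    unfolding EqRel_def refl_on_def equiv_def by blast
  moreover have "sym (EqRel P A)"
    unfolding EqRel_def sym_def equiv_def by blast
  moreover have "trans (EqRel P A)"
    unfolding EqRel_def trans_def equiv_def by blast
  ultimately show ?thesis by (simp add: equiv_def)
qed

end

theory Submission
  imports Defs
begin

text \<open>
  For equivalence relations \<open>E\<close> and \<open>V\<close>, the databases induced by \<open>E, V\<close> over the given schema and by
  \<open>V \<union> V\<^sub>E\<close> over the all-value schema coincide, so all queries have the same answers in both.
  Value rules and denial constraints are therefore kept. An object rule \<open>q(x,y) \<rightarrow> EqO(x,y)\<close> becomes a
  value rule: two atoms with new tid variables are added to \<open>q\<close>, containing \<open>x\<close> and \<open>y\<close> at
  object positions where these variables already occur, and the rule identifies the two cells.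
  Finally, hard rules identify any two object positions whose values intersect; they generate
  \<open>V\<^sub>E\<close> for the trivial \<open>E\<close>. A candidate of the new specification need not be closed under these
  rules, but as rule bodies contain no inequalities, they are monotone, and its derivation
  can be replayed in the original specification; closedness, which holds for solutions, then gives
  equality.
\<close>


section \<open>Equivalence relations\<close>

text \<open>The obstacle is the starting point: originally all occurrences of one object count as
  the same from the outset, whereas over the all-value schema every position starts as a class of
  its own, and rules may fire in any order. Intermediate relations therefore need not have the form
  \<open>merge D E V\<close>, and derivations can only be compared by inclusion. Denial constraints
  may contain inequalities and are not monotone, but they are tested on solutions only, where the
  relations are equal. The equality rules must be hard: soft ones would admit solutions that keep
  occurrences of one object apart. An object rule needs new atoms because a value rule demands two
  distinct tid variables, each occurring once. In an atom that already contains \<open>x\<close> or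
  \<open>y\<close>, the tid term may be a constant or a shared variable, and both may occur in the
  same atom. Objects and values are disjoint, so \<open>V\<close> and \<open>V\<^sub>E\<close> act
  on disjoint sets of positions and their union needs no further closure.\<close>

lemma EqRel_least: "equiv A r \<Longrightarrow> P \<subseteq> r \<Longrightarrow> EqRel P A \<subseteq> r"
  unfolding EqRel_def by blast

lemma EqRel_superset: "P \<subseteq> EqRel P A"
  unfolding EqRel_def by blast

lemma EqRel_eqI:
  assumes "equiv A r" "P \<subseteq> r" "\<And>r'. equiv A r' \<Longrightarrow> P \<subseteq> r' \<Longrightarrow> r \<subseteq> r'"
  shows "EqRel P A = r"
  using assms unfolding EqRel_def by blast

lemma equiv_Id_on: "equiv A (Id_on A)"
  by (auto simp: equiv_def refl_on_def sym_def trans_def)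

lemma EqRel_empty: "EqRel {} A = Id_on A"
  by (rule EqRel_eqI[OF equiv_Id_on]) (auto simp: equiv_def refl_on_def)

text \<open>Closing after each added pair agrees with closing once at the end. This lets a
  derivation, which adds one pair per rule application, reach the closure of a finite set.\<close>

lemma EqRel_insert_EqRel:
  assumes "insert p P \<subseteq> A \<times> A"
  shows "EqRel (EqRel P A \<union> {p}) A = EqRel (insert p P) A"
proof (rule EqRel_eqI)
  show eq: "equiv A (EqRel (insert p P) A)" using assms by (rule equiv_EqRel)
  show "EqRel P A \<union> {p} \<subseteq> EqRel (insert p P) A"
    using EqRel_least[OF eq, of P] EqRel_superset[of "insert p P" A] by blast
  show "EqRel (insert p P) A \<subseteq> r" if "equiv A r" "EqRel P A \<union> {p} \<subseteq> r" for r
    using that EqRel_superset[of P A] by (intro EqRel_least) auto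
qed

text \<open>A chain that crosses the new edge twice returns to a class already visited and can be
  shortened, so one crossing suffices, in either direction. The explicit form makes closures on
  objects, on cells and on all positions comparable.\<close>

lemma EqRel_join:
  assumes "equiv A r" "a \<in> A" "b \<in> A"
  shows "EqRel (r \<union> {(a, b)}) A =
    r \<union> {(x, y). (x, a) \<in> r \<and> (b, y) \<in> r} \<union> {(x, y). (x, b) \<in> r \<and> (a, y) \<in> r}" (is "_ = ?r")
proof (rule EqRel_eqI)
  have sub: "r \<subseteq> A \<times> A" and refl: "\<And>x. x \<in> A \<Longrightarrow> (x, x) \<in> r"
    and sym: "\<And>x y. (x, y) \<in> r \<Longrightarrow> (y, x) \<in> r"
    and trans: "\<And>x y z. (x, y) \<in> r \<Longrightarrow> (y, z) \<in> r \<Longrightarrow> (x, z) \<in> r"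
    using assms(1) unfolding equiv_def refl_on_def sym_def trans_def by blast+
  show "equiv A ?r"
  proof (rule equivI)
    show "?r \<subseteq> A \<times> A" using sub by blast
    show "refl_on A ?r" using refl by (auto simp: refl_on_def)
    show "sym ?r"
      by (intro symI, unfold Un_iff mem_Collect_eq case_prod_conv, elim disjE conjE; meson sym)
    show "trans ?r"
      by (intro transI, unfold Un_iff mem_Collect_eq case_prod_conv, elim disjE conjE; meson trans)
  qed
  show "r \<union> {(a, b)} \<subseteq> ?r" using refl assms by auto
  show "?r \<subseteq> r'" if "equiv A r'" "r \<union> {(a, b)} \<subseteq> r'" for r'
  proof -
    have "sym r'" "trans r'" using that(1) by (auto simp: equiv_def)
    have ab: "(a, b) \<in> r'" and r: "r \<subseteq> r'" using that(2) by blast+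
    have ba: "(b, a) \<in> r'" using \<open>sym r'\<close> ab by (rule symD)
    have "(x, y) \<in> r'" if "(x, u) \<in> r'" "(u, v) \<in> r'" "(v, y) \<in> r'" for x y u v
      using \<open>trans r'\<close> that by (meson transD)
    then show ?thesis using r ab ba by blast
  qed
qed


section \<open>Matches in the all-value schema\<close>

text \<open>This is \<open>induced_arg\<close> over an all-value schema, where the branch for object
  positions never applies.\<close>

definition block ::
  "('r, 'o, 'v, 't) fact set \<Rightarrow> ('o, 'v, 't) cell rel \<Rightarrow> ('o, 'v, 't) const list \<Rightarrow> nat
    \<Rightarrow> ('o, 'v, 't) const set" where
  "block D W cs k = (if k = 0 then {cs ! 0} else {const_at D p | p. ((cs ! 0, k), p) \<in> W})"

definition denot ::
  "('r, 'o, 'v, 't) fact set \<Rightarrow> ('o, 'v, 't) cell rel \<Rightarrow> ('r, 's, 'o, 'v, 't) query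
    \<Rightarrow> (nat \<Rightarrow> ('o, 'v, 't) const list) \<Rightarrow> ('o, 'v, 't) trm \<Rightarrow> ('o, 'v, 't) const set" where
  "denot D W q f u = (case u of Const a \<Rightarrow> {a}
     | Var z \<Rightarrow> Dom D \<inter> (\<Inter>(n, k) \<in> occs q (Var z). block D W (f n) k))"

text \<open>Satisfaction with its witnesses reduced to one fact per relational atom: the facts
  determine the argument sets, and these determine the value of every term.\<close>

definition match ::
  "('s \<Rightarrow> ('o, 'v, 't) const rel) \<Rightarrow> ('r, 'o, 'v, 't) fact set \<Rightarrow> ('o, 'v, 't) cell rel
    \<Rightarrow> ('r, 's, 'o, 'v, 't) query \<Rightarrow> (nat \<Rightarrow> ('o, 'v, 't) const list) \<Rightarrow> bool" where
  "match sim D W q f \<longleftrightarrow>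
     (\<forall>n < length (rels q). (fst (rels q ! n), f n) \<in> D \<and>
        length (f n) = length (snd (rels q ! n)) \<and>
        (\<forall>k < length (snd (rels q ! n)). \<forall>a. snd (rels q ! n) ! k = Const a
           \<longrightarrow> a \<in> block D W (f n) k)) \<and>
     (\<forall>u \<in> terms q. denot D W q f u \<subseteq> Dom D \<and> denot D W q f u \<noteq> {}) \<and>
     (\<forall>(z, z') \<in> set (ineqs q). denot D W q f z \<inter> denot D W q f z' = {}) \<and>
     (\<forall>(s, u, u') \<in> set (sims q). \<exists>c \<in> denot D W q f u. \<exists>c' \<in> denot D W q f u'. (c, c') \<in> sim s)"

lemma not_obj_pos_valued [simp]: "\<not> obj_pos (valued S) R i"
  by (auto simp: obj_pos_def valued_def)

lemma induced_arg_valued: "induced_arg (valued S) D {} W R cs k = block D W cs k"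
  by (simp add: induced_arg_def block_def)

lemma Dom_nth: "(R, cs) \<in> D \<Longrightarrow> k < length cs \<Longrightarrow> cs ! k \<in> Dom D"
  unfolding Dom_def by (auto intro!: bexI[of _ "(R, cs)"])

lemma Positions_intro: "(R, cs) \<in> D \<Longrightarrow> 1 \<le> k \<Longrightarrow> k < length cs \<Longrightarrow> (cs ! 0, k) \<in> Positions D"
  unfolding Positions_def by blast

lemma const_at_Dom:
  assumes "database C S D" "p \<in> Positions D"
  shows "const_at D p \<in> Dom D"
proof -
  obtain R cs k where "p = (cs ! 0, k)" "(R, cs) \<in> D" "k < length cs"
    using assms(2) unfolding Positions_def by blast
  then show ?thesis using const_at_eq[OF assms(1)] Dom_nth by metis
qed

lemma nth_in_block:
  assumes "database C S D" "equiv (Positions D) W" "(R, cs) \<in> D" "k < length cs"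
  shows "cs ! k \<in> block D W cs k"
proof (cases "k = 0")
  case False
  then have "((cs ! 0, k), (cs ! 0, k)) \<in> W"
    using assms(2,4) Positions_intro[OF assms(3)] by (simp add: equiv_def refl_on_def)
  then have "const_at D (cs ! 0, k) \<in> block D W cs k" using False unfolding block_def by auto
  then show ?thesis by (simp only: const_at_eq[OF assms(1,3,4)])
qed (simp add: block_def)

lemma block_subset_Dom:
  assumes "database C S D" "equiv (Positions D) W" "(R, cs) \<in> D" "k < length cs"
  shows "block D W cs k \<subseteq> Dom D"
proof -
  have "W \<subseteq> Positions D \<times> Positions D" using assms(2) by (simp add: equiv_def)
  moreover have "cs ! 0 \<in> Dom D" using assms(3,4) by (intro Dom_nth) auto
  ultimately show ?thesis using const_at_Dom[OF assms(1)] unfolding block_def by auto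
qed

lemma block_mono: "W \<subseteq> W' \<Longrightarrow> block D W cs k \<subseteq> block D W' cs k"
  unfolding block_def by auto

section \<open>Satisfaction as existence of a match\<close>

lemma occs_in_terms: "(n, k) \<in> occs q u \<Longrightarrow> u \<in> terms q"
proof -
  assume "(n, k) \<in> occs q u"
  then have "rels q ! n \<in> set (rels q)" "u \<in> set (snd (rels q ! n))" by (auto simp: occs_def)
  then show ?thesis unfolding terms_def by (auto simp: split_beta)
qed

lemma ineqs_in_terms: "(z, z') \<in> set (ineqs q) \<Longrightarrow> z \<in> terms q" "(z, z') \<in> set (ineqs q) \<Longrightarrow> z' \<in> terms q"
  unfolding terms_def by force+

lemma sims_in_sim_terms:
  "(s, u, u') \<in> set (sims q) \<Longrightarrow> u \<in> sim_terms q" "(s, u, u') \<in> set (sims q) \<Longrightarrow> u' \<in> sim_terms q"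
  unfolding sim_terms_def by force+

lemma sim_terms_subset: "sim_terms q \<subseteq> terms q"
  unfolding sim_terms_def terms_def by blast

lemmas sims_in_terms = sims_in_sim_terms[THEN subsetD[OF sim_terms_subset]]

text \<open>There is no freedom in \<open>h\<close> and \<open>g\<close> beyond the facts: each
  \<open>g n\<close> has to be the list of blocks of some fact, and then \<open>h\<close> is forced
  on all terms of the query. Conversely, blocks are nonempty because each contains the constant
  stored at its position.\<close>

lemma sat_iff_match:
  assumes db: "database C S D" and W: "equiv (Positions D) W"
  shows "sat sim (valued T) D {} W q \<longleftrightarrow> (\<exists>f. match sim D W q f)"
proof
  assume "sat sim (valued T) D {} W q"
  then obtain h g where hg: "\<forall>u \<in> terms q. h u \<subseteq> Dom D \<and> h u \<noteq> {}"
    "\<forall>a. Const a \<in> terms q \<longrightarrow> h (Const a) = {a}"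
    "\<forall>z. Var z \<in> terms q \<longrightarrow> h (Var z) = Dom D \<inter> (\<Inter>(n, i) \<in> occs q (Var z). g n i)"
    "\<forall>n < length (rels q). case rels q ! n of (R, us) \<Rightarrow>
           (R, map (g n) [0..<length us]) \<in> induced (valued T) D {} W \<and>
           (\<forall>i < length us. \<forall>a. us ! i = Const a \<longrightarrow> a \<in> g n i)"
    "\<forall>(z, z') \<in> set (ineqs q). h z \<inter> h z' = {}"
    "\<forall>(s, u, u') \<in> set (sims q). \<exists>c \<in> h u. \<exists>c' \<in> h u'. (c, c') \<in> sim s"
    unfolding sat_def by (elim exE conjE) (rule that)
  have "\<exists>cs. (fst (rels q ! n), cs) \<in> D \<and> length cs = length (snd (rels q ! n)) \<and>
      (\<forall>k < length cs. g n k = block D W cs k)" if n: "n < length (rels q)" for n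
  proof -
    obtain R us where Rus: "rels q ! n = (R, us)" by fastforce
    then have "(R, map (g n) [0..<length us]) \<in> induced (valued T) D {} W"
      using hg(4) n by fastforce
    then obtain cs where cs: "(R, cs) \<in> D"
      "map (g n) [0..<length us] = map (block D W cs) [0..<length cs]"
      unfolding induced_def induced_arg_valued by (auto simp: induced_arg_valued)
    then have len: "length us = length cs" by (metis length_map length_upt diff_zero)
    then have "\<forall>k < length cs. g n k = block D W cs k" using cs(2) by simp
    then show ?thesis using cs(1) len Rus by auto
  qed
  then obtain f where f: "\<And>n. n < length (rels q) \<Longrightarrow> (fst (rels q ! n), f n) \<in> D"
    "\<And>n. n < length (rels q) \<Longrightarrow> length (f n) = length (snd (rels q ! n))"
    "\<And>n k. n < length (rels q) \<Longrightarrow> k < length (f n) \<Longrightarrow> g n k = block D W (f n) k"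
    by metis
  \<comment> \<open>The two functions agree only up to the arity of the atom, but occurrences never
    lie beyond it.\<close>
  have "g n k = block D W (f n) k" if "(n, k) \<in> occs q u" for n k u
    using that f by (auto simp: occs_def)
  then have INT: "(\<Inter>(n, k) \<in> occs q u. g n k) = (\<Inter>(n, k) \<in> occs q u. block D W (f n) k)" for u
    by (intro INF_cong) auto
  have den: "denot D W q f u = h u" if "u \<in> terms q" for u
    using that hg(2,3) INT by (cases u) (auto simp: denot_def)
  have "match sim D W q f"
    unfolding match_def
  proof (intro conjI allI impI ballI)
    fix n assume n: "n < length (rels q)"
    show "(fst (rels q ! n), f n) \<in> D" "length (f n) = length (snd (rels q ! n))"
      using f n by auto
    fix k a assume "k < length (snd (rels q ! n))" "snd (rels q ! n) ! k = Const a"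
    moreover have "\<forall>k < length (snd (rels q ! n)). \<forall>a. snd (rels q ! n) ! k = Const a \<longrightarrow> a \<in> g n k"
      using hg(4) n by (simp add: split_beta)
    ultimately show "a \<in> block D W (f n) k" using f(2,3)[OF n] by metis
  next
    fix u assume "u \<in> terms q"
    then show "denot D W q f u \<subseteq> Dom D" "denot D W q f u \<noteq> {}" using hg(1) den by auto
  next
    fix p assume p: "p \<in> set (ineqs q)"
    obtain z z' where "p = (z, z')" by fastforce
    then show "case p of (z, z') \<Rightarrow> denot D W q f z \<inter> denot D W q f z' = {}"
      using hg(5) p den[OF ineqs_in_terms(1)] den[OF ineqs_in_terms(2)] by auto
  next
    fix p assume p: "p \<in> set (sims q)"
    obtain s u u' where "p = (s, u, u')" by (metis prod.collapse)
    then show "case p of (s, u, u') \<Rightarrow>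
        \<exists>c \<in> denot D W q f u. \<exists>c' \<in> denot D W q f u'. (c, c') \<in> sim s"
      using hg(6) p den[OF sims_in_terms(1)] den[OF sims_in_terms(2)] by auto
  qed
  then show "\<exists>f. match sim D W q f" by blast
next
  assume "\<exists>f. match sim D W q f"
  then obtain f where f: "match sim D W q f" by blast
  let ?g = "\<lambda>n. block D W (f n)"
  have f': "(fst (rels q ! n), f n) \<in> D" "length (f n) = length (snd (rels q ! n))"
    "\<forall>k < length (snd (rels q ! n)). \<forall>a. snd (rels q ! n) ! k = Const a \<longrightarrow> a \<in> ?g n k"
    if "n < length (rels q)" for n
    using f that unfolding match_def by simp_all
  have gD: "\<forall>n < length (rels q). \<forall>i < length (snd (rels q ! n)). ?g n i \<subseteq> Dom D \<and> ?g n i \<noteq> {}"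
  proof (intro allI impI)
    fix n i assume "n < length (rels q)" "i < length (snd (rels q ! n))"
    then have "(fst (rels q ! n), f n) \<in> D" "i < length (f n)" using f' by auto
    then show "?g n i \<subseteq> Dom D \<and> ?g n i \<noteq> {}"
      using nth_in_block[OF db W] block_subset_Dom[OF db W] by blast
  qed
  have ind: "\<forall>n < length (rels q). case rels q ! n of (R, us) \<Rightarrow>
           (R, map (?g n) [0..<length us]) \<in> induced (valued T) D {} W \<and>
           (\<forall>i < length us. \<forall>a. us ! i = Const a \<longrightarrow> a \<in> ?g n i)"
  proof (intro allI impI)
    fix n assume n: "n < length (rels q)"
    obtain R us where Rus: "rels q ! n = (R, us)" by fastforce
    have "(R, f n) \<in> D" "length us = length (f n)" using f'[OF n] Rus by auto
    then have "(R, map (?g n) [0..<length us]) \<in> induced (valued T) D {} W"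
      unfolding induced_def by (auto simp: induced_arg_valued intro!: rev_image_eqI)
    then show "case rels q ! n of (R, us) \<Rightarrow>
           (R, map (?g n) [0..<length us]) \<in> induced (valued T) D {} W \<and>
           (\<forall>i < length us. \<forall>a. us ! i = Const a \<longrightarrow> a \<in> ?g n i)"
      using f'(3)[OF n] Rus by simp
  qed
  show "sat sim (valued T) D {} W q"
    unfolding sat_def
  proof (intro exI conjI)
    show "\<forall>u \<in> terms q. denot D W q f u \<subseteq> Dom D \<and> denot D W q f u \<noteq> {}"
      "\<forall>(z, z') \<in> set (ineqs q). denot D W q f z \<inter> denot D W q f z' = {}"
      "\<forall>(s, u, u') \<in> set (sims q). \<exists>c \<in> denot D W q f u. \<exists>c' \<in> denot D W q f u'. (c, c') \<in> sim s"
      using f unfolding match_def by simp_all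
  qed (use gD ind in \<open>simp_all add: denot_def\<close>)
qed

text \<open>The relation enters through membership in blocks, and only positively once there are no
  inequality atoms; disjointness would be destroyed by larger blocks.\<close>

lemma match_mono:
  assumes "match sim D W q f" "W \<subseteq> W'" "ineqs q = []"
  shows "match sim D W' q f"
proof -
  have b: "a \<in> block D W' cs k" if "a \<in> block D W cs k" for a cs k
    using that block_mono[OF assms(2)] by blast
  have d: "denot D W q f u \<subseteq> denot D W' q f u" for u
    using b by (fastforce simp: denot_def split: trm.splits)
  show ?thesis unfolding match_def
  proof (intro conjI allI impI ballI)
    fix u assume "u \<in> terms q"
    then have "denot D W q f u \<subseteq> Dom D" "denot D W q f u \<noteq> {}" using assms(1) by (auto simp: match_def)
    then show "denot D W' q f u \<subseteq> Dom D" "denot D W' q f u \<noteq> {}"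
      using d[of u] by (cases u; auto simp: denot_def)+
  next
    fix p assume p: "p \<in> set (sims q)"
    obtain s u u' where pe: "p = (s, u, u')" by (metis prod.collapse)
    then have "\<exists>c \<in> denot D W q f u. \<exists>c' \<in> denot D W q f u'. (c, c') \<in> sim s"
      using assms(1) p unfolding match_def by auto
    then show "case p of (s, u, u') \<Rightarrow>
        \<exists>c \<in> denot D W' q f u. \<exists>c' \<in> denot D W' q f u'. (c, c') \<in> sim s"
      using d[of u] d[of u'] unfolding pe by auto
  qed (use assms b in \<open>auto simp: match_def\<close>)
qed

lemma ineqs_subst [simp]: "ineqs q = [] \<Longrightarrow> ineqs (subst \<sigma> q) = []"
  by (simp add: subst_def)

lemma answers_mono:
  assumes "database C S D" "equiv (Positions D) W" "equiv (Positions D) W'" "W \<subseteq> W'" "ineqs q = []"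
  shows "answers sim (valued T) D {} W q x y \<subseteq> answers sim (valued T) D {} W' q x y"
proof -
  have "\<exists>f. match sim D W' (subst \<sigma> q) f" if "match sim D W (subst \<sigma> q) f" for \<sigma> f
    using match_mono[OF that assms(4)] assms(5) by auto
  then show ?thesis
    unfolding answers_def sat_iff_match[OF assms(1,2)] sat_iff_match[OF assms(1,3)] by auto
qed

text \<open>After the substitution the occurrence is a constant, and constants have to belong to the
  argument set at their position. At position 0 this makes the answer the tid of a fact; at an
  object position it supplies a fact for a linking atom.\<close>

lemma sat_subst_occurrence:
  assumes db: "database C S D" and W: "equiv (Positions D) W"
    and sat: "sat sim (valued T) D {} W (subst \<sigma> q)" and "\<sigma> x = Some c" and o: "(n, k) \<in> occs q (Var x)"
  shows "\<exists>cs. (fst (rels q ! n), cs) \<in> D \<and> k < length cs \<and> c \<in> block D W cs k"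
proof -
  obtain f where f: "match sim D W (subst \<sigma> q) f" using sat sat_iff_match[OF db W] by blast
  obtain R us where Rus: "rels q ! n = (R, us)" by fastforce
  have n: "n < length (rels q)" "k < length us" "us ! k = Var x" using o Rus by (auto simp: occs_def)
  then have "rels (subst \<sigma> q) ! n = (R, map (subst_trm \<sigma>) us)" "n < length (rels (subst \<sigma> q))"
    using Rus by (auto simp: subst_def)
  then have "(R, f n) \<in> D" "length (f n) = length us" "c \<in> block D W (f n) k"
    using f n(2,3) assms(4) unfolding match_def by fastforce+
  then show ?thesis using Rus n(2) by auto
qed


section \<open>Queries extended by two linking atoms\<close>

text \<open>All variables of the linking atoms other than \<open>a\<close> must be new and pairwise distinct. The two
  atoms use offsets \<open>m\<close> and \<open>Suc m\<close>, so that parity keeps their variables apart; the variables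
  \<open>m\<close> and \<open>Suc m\<close> themselves are left for the tid positions.\<close>

definition link ::
  "('o, 'v, 't) trm \<Rightarrow> 'r \<Rightarrow> nat \<Rightarrow> nat \<Rightarrow> nat \<Rightarrow> nat \<Rightarrow> 'r \<times> ('o, 'v, 't) trm list" where
  "link p R N i a m = (R, p # map (\<lambda>k. Var (if k = i then a else m + 2 * k)) [1..<N])"

definition extend ::
  "('r, 's, 'o, 'v, 't) query \<Rightarrow> 'r \<times> ('o, 'v, 't) trm list \<Rightarrow> 'r \<times> ('o, 'v, 't) trm list
    \<Rightarrow> ('r, 's, 'o, 'v, 't) query" where
  "extend q l l' = Query (rels q @ [l, l']) (sims q) []"

lemma fst_link [simp]: "fst (link p R N i a m) = R"
  by (simp add: link_def)

lemma length_link [simp]: "1 \<le> N \<Longrightarrow> length (snd (link p R N i a m)) = N"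
  by (simp add: link_def)

lemma nth_link:
  "k < N \<Longrightarrow> snd (link p R N i a m) ! k =
     (if k = 0 then p else Var (if k = i then a else m + 2 * k))"
  by (cases k) (auto simp: link_def)

lemma rels_extend_nth:
  "n < length (rels q) \<Longrightarrow> rels (extend q l l') ! n = rels q ! n"
  "rels (extend q l l') ! length (rels q) = l"
  "rels (extend q l l') ! Suc (length (rels q)) = l'"
  by (auto simp: extend_def nth_append)

lemma length_rels_extend [simp]: "length (rels (extend q l l')) = Suc (Suc (length (rels q)))"
  by (simp add: extend_def)

lemma sims_extend [simp]: "sims (extend q l l') = sims q" "ineqs (extend q l l') = []"
  by (simp_all add: extend_def)

lemma sim_terms_extend [simp]: "sim_terms (extend q l l') = sim_terms q"
  by (simp add: sim_terms_def)

lemma occs_extend: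
  "occs (extend q l l') u = occs q u
     \<union> {(length (rels q), k) | k. k < length (snd l) \<and> snd l ! k = u}
     \<union> {(Suc (length (rels q)), k) | k. k < length (snd l') \<and> snd l' ! k = u}"
  by (auto simp: occs_def rels_extend_nth nth_append extend_def less_Suc_eq split: if_splits)

lemma terms_extend:
  "ineqs q = [] \<Longrightarrow> terms (extend q l l') = terms q \<union> set (snd l) \<union> set (snd l')"
  by (auto simp: terms_def extend_def split_beta)

section \<open>Fresh variables and instantiation of the tid variables\<close>

definition fresh_for :: "nat \<Rightarrow> ('r, 's, 'o, 'v, 't) query \<Rightarrow> bool" where
  "fresh_for m q \<longleftrightarrow> (\<forall>z. Var z \<in> terms q \<longrightarrow> z < m)"

lemma finite_terms: "finite (terms q)"
  unfolding terms_def by auto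

lemma ex_fresh_for: "\<exists>m. fresh_for m q \<and> a < m \<and> b < m"
proof -
  have "finite (insert a (insert b (Var -` terms q)))"
    using finite_terms[of q] by (simp add: finite_vimageI inj_def)
  then obtain m where "\<forall>z \<in> insert a (insert b (Var -` terms q)). z < m"
    using finite_nat_set_iff_bounded by blast
  then show ?thesis unfolding fresh_for_def by (intro exI[of _ m]) simp
qed

lemma subst_ident:
  assumes "\<And>z. Var z \<in> terms q \<Longrightarrow> \<sigma> z = None"
  shows "subst \<sigma> q = q"
proof -
  have t: "subst_trm \<sigma> u = u" if "u \<in> terms q" for u
    using assms that by (cases u) auto
  have "map (subst_trm \<sigma>) us = us" if "(R, us) \<in> set (rels q)" for R us
    using that by (intro map_idI t) (auto simp: terms_def)
  then have "map (\<lambda>(R, us). (R, map (subst_trm \<sigma>) us)) (rels q) = rels q"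
    by (intro map_idI) auto
  moreover have "map (\<lambda>(s, u, u'). (s, subst_trm \<sigma> u, subst_trm \<sigma> u')) (sims q) = sims q"
    by (intro map_idI) (auto intro!: t simp: sims_in_terms)
  moreover have "map (\<lambda>(z, z'). (subst_trm \<sigma> z, subst_trm \<sigma> z')) (ineqs q) = ineqs q"
    by (intro map_idI) (auto intro!: t simp: ineqs_in_terms)
  ultimately show ?thesis unfolding subst_def by simp
qed

text \<open>The variables \<open>m\<close> and \<open>Suc m\<close> occur in the tid positions only:
  the original variables and \<open>a\<close>, \<open>b\<close> lie below \<open>m\<close>, and the
  other new variables start at \<open>m + 2\<close> because \<open>k\<close> starts at 1.\<close>

lemma subst_extend_link:
  assumes "fresh_for m q" "a < m" "b < m" "ineqs q = []"
  shows "subst [m \<mapsto> t, Suc m \<mapsto> t'] (extend q (link (Var m) R N i a m) (link (Var (Suc m)) R' N' j b (Suc m)))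
    = extend q (link (Const t) R N i a m) (link (Const t') R' N' j b (Suc m))"
proof -
  let ?\<sigma> = "[m \<mapsto> t, Suc m \<mapsto> t']"
  have "subst ?\<sigma> q = q" using assms(1) by (intro subst_ident) (force simp: fresh_for_def)
  then have "map (\<lambda>(R, us). (R, map (subst_trm ?\<sigma>) us)) (rels q) = rels q"
    "map (\<lambda>(s, u, u'). (s, subst_trm ?\<sigma> u, subst_trm ?\<sigma> u')) (sims q) = sims q"
    unfolding subst_def by (metis query.sel(1), metis query.sel(2))
  moreover have "map (subst_trm ?\<sigma> \<circ> (\<lambda>k. Var (if k = i then a else m + 2 * k))) [1..<N] =
      map (\<lambda>k. Var (if k = i then a else m + 2 * k)) [1..<N]"
    "map (subst_trm ?\<sigma> \<circ> (\<lambda>k. Var (if k = j then b else Suc m + 2 * k))) [1..<N'] =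
      map (\<lambda>k. Var (if k = j then b else Suc m + 2 * k)) [1..<N']"
    using assms(2,3) by auto
  ultimately show ?thesis by (simp add: subst_def extend_def link_def)
qed

section \<open>Matches of substituted queries\<close>

lemma terms_subst: "terms (subst \<sigma> q) = subst_trm \<sigma> ` terms q"
  unfolding terms_def subst_def by (auto simp: split_beta image_Un image_UN)

lemma subst_trm_eq_Var: "subst_trm \<sigma> u = Var z \<longleftrightarrow> u = Var z \<and> \<sigma> z = None"
  by (cases u) (auto split: option.splits)

lemma subst_trm_eq_Const:
  "subst_trm \<sigma> u = Const c \<longleftrightarrow> u = Const c \<or> (\<exists>z. u = Var z \<and> \<sigma> z = Some c)"
  by (cases u) (auto split: option.splits)

lemma occs_subst: "occs (subst \<sigma> q) (Var z) = (if \<sigma> z = None then occs q (Var z) else {})"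
  unfolding occs_def subst_def by (auto simp: subst_trm_eq_Var split_beta)

lemma rels_subst_nth:
  "n < length (rels q) \<Longrightarrow>
     rels (subst \<sigma> q) ! n = (fst (rels q ! n), map (subst_trm \<sigma>) (snd (rels q ! n)))"
  by (simp add: subst_def split_beta)

lemma length_rels_subst [simp]: "length (rels (subst \<sigma> q)) = length (rels q)"
  by (simp add: subst_def)

lemma denot_Var_iff:
  "w \<in> denot D W q f (Var z) \<longleftrightarrow>
     w \<in> Dom D \<and> (\<forall>(n, k) \<in> occs q (Var z). w \<in> block D W (f n) k)"
  by (auto simp: denot_def)

lemma denot_subst:
  "subst_trm \<sigma> u = u \<Longrightarrow> denot D W (subst \<sigma> q) f u = denot D W q f u"
  by (cases u) (auto simp: denot_def occs_subst split: option.splits)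

text \<open>Moves the substitution out of the query, so that matches are described by the
  occurrences in \<open>q\<close> itself and can be compared with matches of an extension of
  \<open>q\<close> in which the same variables stay variables. Similarity terms are left alone by
  the substitution, hence keep their denotation.\<close>

lemma match_subst_iff:
  assumes "ineqs q = []" "\<forall>u \<in> sim_terms q. subst_trm \<sigma> u = u"
  shows "match sim D W (subst \<sigma> q) f \<longleftrightarrow>
    (\<forall>n < length (rels q). (fst (rels q ! n), f n) \<in> D \<and> length (f n) = length (snd (rels q ! n))) \<and>
    (\<forall>e. \<forall>(n, k) \<in> occs q (Const e). e \<in> block D W (f n) k) \<and>
    (\<forall>x c. \<sigma> x = Some c \<longrightarrow> (\<forall>(n, k) \<in> occs q (Var x). c \<in> block D W (f n) k)) \<and>
    (\<forall>e. Const e \<in> terms q \<longrightarrow> e \<in> Dom D) \<and>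
    (\<forall>x c. \<sigma> x = Some c \<and> Var x \<in> terms q \<longrightarrow> c \<in> Dom D) \<and>
    (\<forall>z. Var z \<in> terms q \<and> \<sigma> z = None \<longrightarrow> denot D W q f (Var z) \<noteq> {}) \<and>
    (\<forall>(s, u, u') \<in> set (sims q). \<exists>c \<in> denot D W q f u. \<exists>c' \<in> denot D W q f u'. (c, c') \<in> sim s)"
    (is "_ \<longleftrightarrow> ?F \<and> ?C \<and> ?X \<and> ?CD \<and> ?XD \<and> ?V \<and> ?S")
proof -
  let ?q = "subst \<sigma> q"
  have F: "(\<forall>n < length (rels ?q). (fst (rels ?q ! n), f n) \<in> D \<and>
        length (f n) = length (snd (rels ?q ! n)) \<and>
        (\<forall>k < length (snd (rels ?q ! n)). \<forall>a. snd (rels ?q ! n) ! k = Const a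
           \<longrightarrow> a \<in> block D W (f n) k)) \<longleftrightarrow> ?F \<and> ?C \<and> ?X"
    by (auto simp: rels_subst_nth subst_trm_eq_Const occs_def)
  have T: "(\<forall>u \<in> terms ?q. denot D W ?q f u \<subseteq> Dom D \<and> denot D W ?q f u \<noteq> {}) \<longleftrightarrow> ?CD \<and> ?XD \<and> ?V"
    (is "?T \<longleftrightarrow> _")
  proof
    assume T: ?T
    then have *: "denot D W ?q f (subst_trm \<sigma> u) \<subseteq> Dom D \<and> denot D W ?q f (subst_trm \<sigma> u) \<noteq> {}"
      if "u \<in> terms q" for u
      using that by (auto simp: terms_subst)
    have ?CD using *[of "Const _"] by (auto simp: denot_def)
    moreover have ?XD using *[of "Var _"] by (fastforce simp: denot_def)
    moreover have ?V
    proof (intro allI impI)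
      fix z assume "Var z \<in> terms q \<and> \<sigma> z = None"
      then show "denot D W q f (Var z) \<noteq> {}" using *[of "Var z"] denot_subst[of \<sigma> "Var z" D W q f] by simp
    qed
    ultimately show "?CD \<and> ?XD \<and> ?V" by blast
  next
    assume A: "?CD \<and> ?XD \<and> ?V"
    show ?T
    proof
      fix u' assume "u' \<in> terms ?q"
      then obtain u where u: "u \<in> terms q" "u' = subst_trm \<sigma> u" by (auto simp: terms_subst)
      show "denot D W ?q f u' \<subseteq> Dom D \<and> denot D W ?q f u' \<noteq> {}"
      proof (cases u')
        case (Const c)
        then have "c \<in> Dom D" using u A by (metis subst_trm_eq_Const)
        then show ?thesis using Const by (simp add: denot_def)
      next
        case (Var z)
        then have "u = Var z" "\<sigma> z = None" using u by (metis subst_trm_eq_Var)+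
        then have "denot D W ?q f u' \<noteq> {}" using A u Var denot_subst[of \<sigma> "Var z" D W q f] by simp
        then show ?thesis using Var by (auto simp: denot_def)
      qed
    qed
  qed
  have sims: "set (sims ?q) = set (sims q)"
  proof -
    have "map (\<lambda>(s, u, u'). (s, subst_trm \<sigma> u, subst_trm \<sigma> u')) (sims q) = sims q"
      by (intro map_idI) (auto simp: assms(2) sims_in_sim_terms)
    then show ?thesis by (simp add: subst_def)
  qed
  have den: "denot D W ?q f u = denot D W q f u" if "u \<in> sim_terms q" for u
    using assms(2)[rule_format, OF that] by (rule denot_subst)
  have S: "(\<forall>(s, u, u') \<in> set (sims ?q). \<exists>c \<in> denot D W ?q f u.
      \<exists>c' \<in> denot D W ?q f u'. (c, c') \<in> sim s) \<longleftrightarrow> ?S"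
  proof (intro ball_cong[OF sims])
    fix p assume p: "p \<in> set (sims q)"
    obtain s u u' where "p = (s, u, u')" by (metis prod.collapse)
    moreover from this p have "u \<in> sim_terms q" "u' \<in> sim_terms q"
      using sims_in_sim_terms by fast+
    ultimately show "(case p of (s, u, u') \<Rightarrow> \<exists>c \<in> denot D W ?q f u. \<exists>c' \<in> denot D W ?q f u'. (c, c') \<in> sim s)
      \<longleftrightarrow> (case p of (s, u, u') \<Rightarrow> \<exists>c \<in> denot D W q f u. \<exists>c' \<in> denot D W q f u'. (c, c') \<in> sim s)"
      using den by simp
  qed
  show ?thesis unfolding match_def using assms(1) by (simp only: F T S) (simp add: conj_assoc)
qed

lemma match_iff:
  fixes q :: "('r, 's, 'o, 'v, 't) query"
  assumes "ineqs q = []"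
  shows "match sim D W q f \<longleftrightarrow>
    (\<forall>n < length (rels q). (fst (rels q ! n), f n) \<in> D \<and> length (f n) = length (snd (rels q ! n))) \<and>
    (\<forall>e. \<forall>(n, k) \<in> occs q (Const e). e \<in> block D W (f n) k) \<and>
    (\<forall>e. Const e \<in> terms q \<longrightarrow> e \<in> Dom D) \<and>
    (\<forall>z. Var z \<in> terms q \<longrightarrow> denot D W q f (Var z) \<noteq> {}) \<and>
    (\<forall>(s, u, u') \<in> set (sims q). \<exists>c \<in> denot D W q f u. \<exists>c' \<in> denot D W q f u'. (c, c') \<in> sim s)"
proof -
  have "subst_trm Map.empty u = u" for u :: "('o, 'v, 't) trm" by (cases u) auto
  then show ?thesis
    using match_subst_iff[of q Map.empty sim D W f] subst_ident[of q Map.empty] assms by simp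
qed

text \<open>In the extended query \<open>a\<close> and \<open>b\<close> are existential and denote
  intersections of blocks; any element of such an intersection may replace the variable by a
  constant, since no similarity atom looks at \<open>a\<close> or \<open>b\<close>. Conversely, the
  constants witness that the intersections are nonempty. The remaining new variables occur once each
  and restrict nothing.\<close>

lemma ex_match_extend_iff:
  fixes q :: "('r, 's, 'o, 'v, 't) query"
  assumes db: "database C T D" and W: "equiv (Positions D) W"
    and m: "fresh_for m q" "a < m" "b < m"
    and q: "ineqs q = []" "Var a \<notin> sim_terms q" "Var b \<notin> sim_terms q"
    and ij: "1 \<le> i" "i < N" "1 \<le> j" "j < N'"
    and N: "\<And>cs. (R, cs) \<in> D \<Longrightarrow> length cs = N" and N': "\<And>cs. (R', cs) \<in> D \<Longrightarrow> length cs = N'"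
  shows "(\<exists>f. match sim D W (extend q (link (Const t) R N i a m) (link (Const t') R' N' j b (Suc m))) f) \<longleftrightarrow>
    (\<exists>cs cs' c c'. (R, cs) \<in> D \<and> t = cs ! 0 \<and> (R', cs') \<in> D \<and> t' = cs' ! 0 \<and>
       c \<in> block D W cs i \<and> c' \<in> block D W cs' j \<and> (a = b \<longrightarrow> c = c') \<and>
       (\<exists>f. match sim D W (subst [a \<mapsto> c, b \<mapsto> c'] q) f))"
    (is "(\<exists>f. match sim D W ?q f) \<longleftrightarrow> ?rhs")
proof -
  let ?l = "link (Const t) R N i a m" and ?l' = "link (Const t') R' N' j b (Suc m)"
  let ?L = "length (rels q)"
  have len: "length (snd ?l) = N" "length (snd ?l') = N'" using ij by auto
  have nth: "snd ?l ! k = (if k = 0 then Const t else Var (if k = i then a else m + 2 * k))"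
    if "k < N" for k using that by (rule nth_link)
  have nth': "snd ?l' ! k = (if k = 0 then Const t' else Var (if k = j then b else Suc m + 2 * k))"
    if "k < N'" for k using that by (rule nth_link)
  have occs: "(n, k) \<in> occs ?q u \<longleftrightarrow> (n, k) \<in> occs q u \<or> n = ?L \<and> k < N \<and> snd ?l ! k = u
      \<or> n = Suc ?L \<and> k < N' \<and> snd ?l' ! k = u" for n k u
    unfolding occs_extend len by auto
  have occs_lt: "n < ?L" if "(n, k) \<in> occs q u" for n k u
    using that by (simp add: occs_def)
  have occsC: "(n, k) \<in> occs ?q (Const e) \<longleftrightarrow> (n, k) \<in> occs q (Const e) \<or>
      n = ?L \<and> k = 0 \<and> e = t \<or> n = Suc ?L \<and> k = 0 \<and> e = t'" for n k e
    unfolding occs using nth nth' ij by (auto split: if_splits)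
  have occsV: "(n, k) \<in> occs ?q (Var z) \<longleftrightarrow> (n, k) \<in> occs q (Var z) \<or>
      n = ?L \<and> k = i \<and> z = a \<or> n = Suc ?L \<and> k = j \<and> z = b" if "z < m" for n k z
    unfolding occs using nth nth' ij that by (auto split: if_splits)
  have not_occ: "(n, k) \<notin> occs q (Var z)" if "m \<le> z" for n k z
    using that m(1) occs_in_terms[of n k q "Var z"] unfolding fresh_for_def by auto
  have occsF: "n = n' \<and> k = k'"
    if "m \<le> z" "(n, k) \<in> occs ?q (Var z)" "(n', k') \<in> occs ?q (Var z)" for z n k n' k'
  proof -
    have *: "n = ?L \<and> z = m + 2 * k \<or> n = Suc ?L \<and> z = Suc m + 2 * k"
      if "(n, k) \<in> occs ?q (Var z)" for n k
      using that not_occ[OF \<open>m \<le> z\<close>] m(2,3) \<open>m \<le> z\<close> nth[of k] nth'[of k] unfolding occs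
      by (auto split: if_splits)
    show ?thesis using *[OF that(2)] *[OF that(3)] by presburger
  qed
  have set_l: "u \<in> set (snd ?l) \<longleftrightarrow> (\<exists>k < N. snd ?l ! k = u)" for u
    using len by (metis in_set_conv_nth)
  have set_l': "u \<in> set (snd ?l') \<longleftrightarrow> (\<exists>k < N'. snd ?l' ! k = u)" for u
    using len by (metis in_set_conv_nth)
  have terms: "terms ?q = terms q \<union> set (snd ?l) \<union> set (snd ?l')"
    using q(1) by (rule terms_extend)
  have termsC: "Const e \<in> terms ?q \<longleftrightarrow> Const e \<in> terms q \<or> e = t \<or> e = t'" for e
    unfolding terms Un_iff set_l set_l' using nth nth' ij
    by (auto split: if_splits intro: exI[of _ 0])
  have termsV: "Var z \<in> terms q" if "Var z \<in> terms ?q" "z < m" "z \<noteq> a" "z \<noteq> b" for z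
    using that nth nth' unfolding terms Un_iff set_l set_l' by (auto split: if_splits)
  have "snd ?l ! i = Var a" "snd ?l' ! j = Var b" using nth nth' ij by auto
  then have ab: "Var a \<in> terms ?q" "Var b \<in> terms ?q"
    unfolding terms Un_iff set_l set_l' using ij by blast+
  have denot: "denot D W ?q f (Var z) = denot D W q f' (Var z)"
    if "z < m" "z \<noteq> a" "z \<noteq> b" "\<And>n. n < ?L \<Longrightarrow> f n = f' n" for z f f'
  proof -
    have "occs ?q (Var z) = occs q (Var z)" using occsV[OF that(1)] that(2,3) by auto
    moreover have "(\<Inter>(n, k) \<in> occs q (Var z). block D W (f n) k) = (\<Inter>(n, k) \<in> occs q (Var z). block D W (f' n) k)"
      using that(4) occs_lt by (intro INF_cong) auto
    ultimately show ?thesis by (simp add: denot_def)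
  qed
  have sim: "denot D W ?q f u = denot D W q f' u"
    if "u \<in> sim_terms q" "\<And>n. n < ?L \<Longrightarrow> f n = f' n" for u f f'
  proof (cases u)
    case (Var z)
    moreover have "u \<in> terms q" using that(1) sim_terms_subset by blast
    ultimately show ?thesis using that q m(1) denot[of z f f'] unfolding fresh_for_def by auto
  qed (simp add: denot_def)
  have sims: "(\<forall>(s, u, u') \<in> set (sims q). \<exists>c \<in> denot D W ?q f u. \<exists>c' \<in> denot D W ?q f u'. (c, c') \<in> sim s)
    \<longleftrightarrow> (\<forall>(s, u, u') \<in> set (sims q). \<exists>c \<in> denot D W q f' u. \<exists>c' \<in> denot D W q f' u'. (c, c') \<in> sim s)"
    if "\<And>n. n < ?L \<Longrightarrow> f n = f' n" for f f'
  proof (intro ball_cong refl)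
    fix p assume p: "p \<in> set (sims q)"
    obtain s u u' where "p = (s, u, u')" by (metis prod.collapse)
    moreover from this p have "u \<in> sim_terms q" "u' \<in> sim_terms q"
      using sims_in_sim_terms by fast+
    ultimately show "(case p of (s, u, u') \<Rightarrow> \<exists>c \<in> denot D W ?q f u. \<exists>c' \<in> denot D W ?q f u'. (c, c') \<in> sim s)
      \<longleftrightarrow> (case p of (s, u, u') \<Rightarrow> \<exists>c \<in> denot D W q f' u. \<exists>c' \<in> denot D W q f' u'. (c, c') \<in> sim s)"
      using sim that by simp
  qed
  have subst_sim: "\<forall>u \<in> sim_terms q. subst_trm [a \<mapsto> c, b \<mapsto> c'] u = u" for c c'
  proof
    fix u assume "u \<in> sim_terms q"
    then show "subst_trm [a \<mapsto> c, b \<mapsto> c'] u = u" using q by (cases u) auto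
  qed
  note match_q = match_iff[OF sims_extend(2)[of q ?l ?l']]
  note match_subst = match_subst_iff[OF q(1) subst_sim]
  show ?thesis
  proof
    assume "\<exists>f. match sim D W ?q f"
    then obtain f where f: "match sim D W ?q f" by blast
    note f' = f[unfolded match_q]
    have rel: "(fst (rels ?q ! n), f n) \<in> D" "length (f n) = length (snd (rels ?q ! n))"
      if "n < Suc (Suc ?L)" for n using f' that by auto
    have cs: "(R, f ?L) \<in> D" "(R', f (Suc ?L)) \<in> D"
      using rel(1)[of ?L] rel(1)[of "Suc ?L"] by (simp_all add: rels_extend_nth)
    have C: "e \<in> block D W (f n) k" if "(n, k) \<in> occs ?q (Const e)" for n k e
      using f' that by fast
    have "t \<in> block D W (f ?L) 0" "t' \<in> block D W (f (Suc ?L)) 0"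
      using C occsC by blast+
    then have t: "t = f ?L ! 0" "t' = f (Suc ?L) ! 0" by (simp_all add: block_def)
    have V: "denot D W ?q f (Var z) \<noteq> {}" if "Var z \<in> terms ?q" for z using f' that by blast
    obtain c where c: "c \<in> denot D W ?q f (Var a)" using V[OF ab(1)] by blast
    \<comment> \<open>For \<open>a = b\<close> there is only one variable to instantiate, so
      \<open>c\<close> is reused.\<close>
    obtain c' where c': "c' \<in> denot D W ?q f (Var b)" "a = b \<longrightarrow> c = c'"
      using V[OF ab(2)] c by blast
    have cb: "c \<in> Dom D" "c' \<in> Dom D"
      "\<And>n k. (n, k) \<in> occs ?q (Var a) \<Longrightarrow> c \<in> block D W (f n) k"
      "\<And>n k. (n, k) \<in> occs ?q (Var b) \<Longrightarrow> c' \<in> block D W (f n) k"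
      using c c'(1) by (auto simp: denot_Var_iff)
    have "match sim D W (subst [a \<mapsto> c, b \<mapsto> c'] q) f"
      unfolding match_subst
    proof (intro conjI allI impI)
      fix n assume "n < ?L"
      then show "(fst (rels q ! n), f n) \<in> D" "length (f n) = length (snd (rels q ! n))"
        using rel[of n] by (auto simp: rels_extend_nth)
    next
      fix e show "\<forall>(n, k) \<in> occs q (Const e). e \<in> block D W (f n) k" using C occsC by blast
    next
      fix x e assume x: "[a \<mapsto> c, b \<mapsto> c'] x = Some e"
      then have "x = a \<and> e = c \<or> x = b \<and> e = c'" by (auto split: if_splits)
      then show "\<forall>(n, k) \<in> occs q (Var x). e \<in> block D W (f n) k"
        using cb(3,4) occsV m(2,3) by blast
    next
      fix e assume "Const e \<in> terms q" then show "e \<in> Dom D" using termsC f' by blast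
    next
      fix x e assume "[a \<mapsto> c, b \<mapsto> c'] x = Some e \<and> Var x \<in> terms q"
      then show "e \<in> Dom D" using cb(1,2) by (auto split: if_splits)
    next
      fix z assume z: "Var z \<in> terms q \<and> [a \<mapsto> c, b \<mapsto> c'] z = None"
      then have zm: "z < m" "z \<noteq> a" "z \<noteq> b" "Var z \<in> terms ?q"
        using m(1) unfolding fresh_for_def terms by (auto split: if_splits)
      then show "denot D W q f (Var z) \<noteq> {}" using V[OF zm(4)] denot[OF zm(1-3), of f f] by metis
    next
      show "\<forall>(s, u, u') \<in> set (sims q). \<exists>c \<in> denot D W q f u. \<exists>c' \<in> denot D W q f u'. (c, c') \<in> sim s"
        using f' sims[of f f] by simp
    qed
    moreover have "c \<in> block D W (f ?L) i" "c' \<in> block D W (f (Suc ?L)) j"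
      using cb(3,4) occsV m(2,3) by blast+
    ultimately show ?rhs using cs t c'(2) by blast
  next
    assume ?rhs
    then obtain cs cs' c c' f where *: "(R, cs) \<in> D" "t = cs ! 0" "(R', cs') \<in> D" "t' = cs' ! 0"
      "c \<in> block D W cs i" "c' \<in> block D W cs' j" "a = b \<longrightarrow> c = c'"
      "match sim D W (subst [a \<mapsto> c, b \<mapsto> c'] q) f" by blast
    note f = *(8)[unfolded match_subst]
    define F where "F = f(?L := cs, Suc ?L := cs')"
    have F: "F ?L = cs" "F (Suc ?L) = cs'" "\<And>n. n < ?L \<Longrightarrow> F n = f n"
      by (auto simp: F_def)
    have lens: "length cs = N" "length cs' = N'" using N N' * by auto
    have dom: "c \<in> Dom D" "c' \<in> Dom D" "t \<in> Dom D" "t' \<in> Dom D"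
      using block_subset_Dom[OF db W *(1)] block_subset_Dom[OF db W *(3)] * ij lens
        Dom_nth[OF *(1)] Dom_nth[OF *(3)] by auto
    have rel: "(fst (rels ?q ! n), F n) \<in> D \<and> length (F n) = length (snd (rels ?q ! n))"
      if n: "n < Suc (Suc ?L)" for n
    proof -
      consider "n < ?L" | "n = ?L" | "n = Suc ?L" using n by linarith
      then show ?thesis
        by cases (use f F *(1,3) lens len in \<open>auto simp: rels_extend_nth\<close>)
    qed
    have "match sim D W ?q F"
      unfolding match_q
    proof (intro conjI allI impI)
      fix n assume "n < length (rels ?q)"
      then show "(fst (rels ?q ! n), F n) \<in> D" "length (F n) = length (snd (rels ?q ! n))"
        using rel by simp_all
    next
      fix e
      have "e \<in> block D W (f n) k" if "(n, k) \<in> occs q (Const e)" for n k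
        using f that by blast
      then have "e \<in> block D W (F n) k" if "(n, k) \<in> occs ?q (Const e)" for n k
        using that *(2,4) F occs_lt[of n k] unfolding occsC by (auto simp: block_def[of _ _ _ 0])
      then show "\<forall>(n, k) \<in> occs ?q (Const e). e \<in> block D W (F n) k" by blast
    next
      fix e assume "Const e \<in> terms ?q" then show "e \<in> Dom D" using termsC f dom by blast
    next
      fix z assume z: "Var z \<in> terms ?q"
      consider "z = a" | "z = b" | "z < m" "z \<noteq> a" "z \<noteq> b" | "m \<le> z" by linarith
      then show "denot D W ?q F (Var z) \<noteq> {}"
      proof cases
        case 1
        have "c \<in> block D W (F n) k" if "(n, k) \<in> occs ?q (Var a)" for n k
        proof -
          \<comment> \<open>For \<open>a = b\<close> the second update overrides the first, which is
            harmless only because then \<open>c = c'\<close>.\<close>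
          have "[a \<mapsto> c, b \<mapsto> c'] a = Some c" using *(7) by auto
          then have "\<forall>(n, k) \<in> occs q (Var a). c \<in> block D W (f n) k" using f by blast
          then show ?thesis using that *(5,6,7) F occs_lt[of n k] unfolding occsV[OF m(2)] by auto
        qed
        then show ?thesis using 1 dom(1) denot_Var_iff[of c D W ?q F a] by blast
      next
        case 2
        have "c' \<in> block D W (F n) k" if "(n, k) \<in> occs ?q (Var b)" for n k
        proof -
          have "[a \<mapsto> c, b \<mapsto> c'] b = Some c'" by simp
          then have "\<forall>(n, k) \<in> occs q (Var b). c' \<in> block D W (f n) k" using f by blast
          then show ?thesis using that *(5,6,7) F occs_lt[of n k] unfolding occsV[OF m(3)] by auto
        qed
        then show ?thesis using 2 dom(2) denot_Var_iff[of c' D W ?q F b] by blast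
      next
        case 3
        then have "denot D W q f (Var z) \<noteq> {}" using f termsV[OF z] by auto
        then show ?thesis using denot[of z F f] 3 F by simp
      next
        case 4
        show ?thesis
        proof (cases "occs ?q (Var z) = {}")
          \<comment> \<open>An empty intersection is read as \<open>Dom D\<close>, which contains
            \<open>c\<close>.\<close>
          case True
          then show ?thesis using dom(1) by (auto simp: denot_def)
        next
          case False
          then obtain n k where nk: "(n, k) \<in> occs ?q (Var z)" by auto
          then have n: "n < Suc (Suc ?L)" "k < length (snd (rels ?q ! n))" by (auto simp: occs_def)
          then have "(fst (rels ?q ! n), F n) \<in> D" "k < length (F n)" using rel by auto
          then have "F n ! k \<in> block D W (F n) k" "F n ! k \<in> Dom D"
            using nth_in_block[OF db W] Dom_nth by metis+
          \<comment> \<open>The variable occurs only here, so it denotes this one block, which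
            contains the stored constant.\<close>
          then have "F n ! k \<in> denot D W ?q F (Var z)"
            unfolding denot_Var_iff using occsF[OF 4 nk] by blast
          then show ?thesis by blast
        qed
      qed
    next
      show "\<forall>(s, u, u') \<in> set (sims ?q). \<exists>c \<in> denot D W ?q F u. \<exists>c' \<in> denot D W ?q F u'. (c, c') \<in> sim s"
        using f sims[of F f] F by simp
    qed
    then show "\<exists>f. match sim D W ?q f" by blast
  qed
qed


section \<open>The equivalence on all positions\<close>

definition merge ::
  "('r, 'o, 'v, 't) fact set \<Rightarrow> ('o, 'v, 't) const rel \<Rightarrow> ('o, 'v, 't) cell rel \<Rightarrow> ('o, 'v, 't) cell rel" where
  "merge D E V = V \<union> pos_rel D E"

context
  fixes S :: "'r schema" and D :: "('r, 'o, 'v, 't) fact set"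
  assumes db: "database std_carrier S D"
begin

lemma obj_pos_const_at:
  assumes "(R, cs) \<in> D" "obj_pos S R k"
  shows "(cs ! 0, k) \<in> Positions D" "const_at D (cs ! 0, k) = cs ! k" "cs ! k \<in> Objs S D"
proof -
  obtain ts where "S R = Some ts" "length cs = Suc (length ts)"
    using database_entry[OF db assms(1)] by metis
  then have k: "1 \<le> k" "k < length cs" using assms(2) unfolding obj_pos_def by auto
  then show "(cs ! 0, k) \<in> Positions D" "const_at D (cs ! 0, k) = cs ! k"
    using Positions_intro[OF assms(1)] const_at_eq[OF db assms(1)] by auto
  show "cs ! k \<in> Objs S D" using assms unfolding Objs_def by blast
qed

lemma Cells_Positions: "p \<in> Cells S D \<Longrightarrow> p \<in> Positions D"
proof -
  assume "p \<in> Cells S D"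
  then obtain R cs k where p: "p = (cs ! 0, k)" "(R, cs) \<in> D" "val_pos S R k"
    unfolding Cells_def by blast
  obtain ts where "S R = Some ts" "length cs = Suc (length ts)"
    using database_entry[OF db p(2)] by metis
  then have "1 \<le> k" "k < length cs" using p(3) unfolding val_pos_def by auto
  then show ?thesis using Positions_intro[OF p(2)] p(1) by simp
qed

text \<open>The carriers of the two types are disjoint. The separation of the two parts of
  \<open>merge\<close> rests on this.\<close>

lemma const_at_Cells: "p \<in> Cells S D \<Longrightarrow> const_at D p \<notin> Objs S D"
proof -
  assume "p \<in> Cells S D"
  then obtain R cs k where p: "p = (cs ! 0, k)" "(R, cs) \<in> D" "val_pos S R k"
    unfolding Cells_def by blast
  obtain ts where ts: "S R = Some ts" "length cs = Suc (length ts)"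
    "\<And>i. 1 \<le> i \<Longrightarrow> i \<le> length ts \<Longrightarrow> cs ! i \<in> std_carrier (ts ! (i - 1))"
    using database_entry[OF db p(2)] by metis
  have k: "1 \<le> k" "k \<le> length ts" "ts ! (k - 1) = VType" using p(3) ts(1) unfolding val_pos_def by auto
  then have "cs ! k \<in> range Val" using ts(3)[OF k(1,2)] by (simp add: std_carrier_def)
  moreover have "const_at D p = cs ! k" using const_at_eq[OF db p(2)] p(1) k ts(2) by simp
  ultimately show ?thesis unfolding Objs_eq[OF db] by auto
qed

lemma Positions_cases:
  assumes "p \<in> Positions D"
  obtains "p \<in> Cells S D" | R cs k where "p = (cs ! 0, k)" "(R, cs) \<in> D" "obj_pos S R k" "const_at D p \<in> Objs S D"
proof -
  obtain R cs k where p: "p = (cs ! 0, k)" "(R, cs) \<in> D" "1 \<le> k" "k < length cs"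
    using assms unfolding Positions_def by blast
  obtain ts where "S R = Some ts" "length cs = Suc (length ts)"
    using database_entry[OF db p(2)] by metis
  then have "obj_pos S R k \<or> val_pos S R k"
    using p(3,4) unfolding obj_pos_def val_pos_def by (cases "ts ! (k - 1)") auto
  then show ?thesis
  proof
    assume o: "obj_pos S R k"
    show ?thesis using that(2)[OF p(1,2) o] obj_pos_const_at[OF p(2) o] p(1) by simp
  next
    assume "val_pos S R k"
    then have "p \<in> Cells S D" using p unfolding Cells_def by blast
    then show ?thesis by (rule that(1))
  qed
qed

lemma Objs_const_at: "c \<in> Objs S D \<Longrightarrow> \<exists>p \<in> Positions D. const_at D p = c"
  using obj_pos_const_at unfolding Objs_def by blast

section \<open>Merging an object equivalence and a cell equivalence\<close>

context
  fixes E V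
  assumes E: "equiv (Objs S D) E" and V: "equiv (Cells S D) V"
begin

lemma E_D: "(c, c') \<in> E \<Longrightarrow> c \<in> Objs S D \<and> c' \<in> Objs S D"
  using E unfolding equiv_def by blast

lemma V_D: "(p, p') \<in> V \<Longrightarrow> p \<in> Cells S D \<and> p' \<in> Cells S D"
  using V unfolding equiv_def by blast

lemma merge_Cells1: "p \<in> Cells S D \<Longrightarrow> (p, p') \<in> merge D E V \<longleftrightarrow> (p, p') \<in> V"
  using const_at_Cells[of p] E_D unfolding merge_def pos_rel_def by auto

lemma merge_Cells2: "p' \<in> Cells S D \<Longrightarrow> (p, p') \<in> merge D E V \<longleftrightarrow> (p, p') \<in> V"
  using const_at_Cells[of p'] E_D unfolding merge_def pos_rel_def by auto

lemma merge_Objs1: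
  "const_at D p \<in> Objs S D \<Longrightarrow> p \<in> Positions D \<Longrightarrow>
    (p, p') \<in> merge D E V \<longleftrightarrow> p' \<in> Positions D \<and> (const_at D p, const_at D p') \<in> E"
  using const_at_Cells[of p] V_D[of p p'] E_D unfolding merge_def pos_rel_def by auto

lemma merge_Objs2:
  "const_at D p' \<in> Objs S D \<Longrightarrow> p' \<in> Positions D \<Longrightarrow>
    (p, p') \<in> merge D E V \<longleftrightarrow> p \<in> Positions D \<and> (const_at D p, const_at D p') \<in> E"
  using const_at_Cells[of p'] V_D[of p p'] E_D unfolding merge_def pos_rel_def by auto

text \<open>\<open>V\<close> lives on the positions holding values, \<open>pos_rel D E\<close> on
  those holding objects. These sets partition all positions, so a chain never passes from one part
  into the other.\<close>

lemma equiv_merge: "equiv (Positions D) (merge D E V)"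
proof (rule equivI)
  have symE: "sym E" "trans E" and symV: "sym V" "trans V"
    using E V by (auto simp: equiv_def)
  show "merge D E V \<subseteq> Positions D \<times> Positions D"
    using V_D Cells_Positions unfolding merge_def pos_rel_def by auto
  show "refl_on (Positions D) (merge D E V)"
    unfolding refl_on_def
  proof
    fix p assume "p \<in> Positions D"
    then show "(p, p) \<in> merge D E V"
    proof (cases rule: Positions_cases)
      case 1
      then show ?thesis using V unfolding merge_def equiv_def refl_on_def by blast
    next
      case 2
      then show ?thesis using E \<open>p \<in> Positions D\<close> unfolding merge_def pos_rel_def equiv_def refl_on_def by blast
    qed
  qed
  show "sym (merge D E V)"
    using symE(1) symV(1) unfolding merge_def pos_rel_def sym_def by auto
  show "trans (merge D E V)"
  proof (rule transI)
    fix x y z assume xy: "(x, y) \<in> merge D E V" and yz: "(y, z) \<in> merge D E V"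
    then have "y \<in> Positions D" using V_D[of x y] Cells_Positions[of y] unfolding merge_def pos_rel_def by auto
    then show "(x, z) \<in> merge D E V"
    proof (cases rule: Positions_cases)
      case 1
      then have "(x, z) \<in> V" using xy yz symV(2) merge_Cells1 merge_Cells2 by (meson transD)
      then show ?thesis by (simp add: merge_def)
    next
      case 2
      then have "x \<in> Positions D" "z \<in> Positions D" "(const_at D x, const_at D z) \<in> E"
        using xy yz symE(2) merge_Objs1 merge_Objs2 \<open>y \<in> Positions D\<close> by (meson transD)+
      then show ?thesis by (simp add: merge_def pos_rel_def)
    qed
  qed
qed

text \<open>Every object of \<open>D\<close> is stored at some position, so collecting the constants
  at equivalent positions yields the whole \<open>E\<close>-class.\<close>

lemma block_merge:
  assumes "(R, cs) \<in> D" "obj_pos S R k"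
  shows "block D (merge D E V) cs k = {c. (cs ! k, c) \<in> E}"
proof -
  note p = obj_pos_const_at[OF assms]
  have "k \<noteq> 0" using assms(2) by (auto simp: obj_pos_def)
  have "((cs ! 0, k), p') \<in> merge D E V \<longleftrightarrow> p' \<in> Positions D \<and> (cs ! k, const_at D p') \<in> E" for p'
    using merge_Objs1[of "(cs ! 0, k)" p'] p by simp
  then have "block D (merge D E V) cs k = {const_at D p' | p'. p' \<in> Positions D \<and> (cs ! k, const_at D p') \<in> E}"
    using \<open>k \<noteq> 0\<close> unfolding block_def by simp
  also have "\<dots> = {c. (cs ! k, c) \<in> E}"
    using E_D Objs_const_at by blast
  finally show ?thesis .
qed

text \<open>At object positions both sides are \<open>E\<close>-classes, at value positions both are
  given by \<open>V\<close>. Query answers then agree as well, because \<open>sat\<close> consults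
  the equivalences only through the induced database.\<close>

lemma induced_merge: "induced S D E V = induced (valued S) D {} (merge D E V)"
proof -
  have "induced_arg S D E V R cs k = block D (merge D E V) cs k" if "(R, cs) \<in> D" "k < length cs" for R cs k
  proof (cases "k = 0 \<or> obj_pos S R k")
    case True
    then show ?thesis using block_merge[OF that(1)]
      by (auto simp: induced_arg_def block_def[of _ _ _ 0])
  next
    case False
    then have "(cs ! 0, k) \<in> Positions D" using that by (intro Positions_intro) auto
    then have "(cs ! 0, k) \<in> Cells S D"
    proof (cases rule: Positions_cases)
      case (2 R' cs' k')
      \<comment> \<open>The tid determines the fact, so \<open>k\<close> would be an object position
        of \<open>R\<close>.\<close>
      then have "(R', cs') = (R, cs)" using db that(1) unfolding database_def by fastforce
      then show ?thesis using 2 False by simp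
    qed
    then show ?thesis using False by (simp add: induced_arg_def block_def merge_Cells1)
  qed
  then show ?thesis unfolding induced_def induced_arg_valued
    by (intro image_cong) (auto simp: induced_arg_valued)
qed

lemma sat_merge: "sat sim S D E V q \<longleftrightarrow> sat sim (valued S) D {} (merge D E V) q"
  unfolding sat_def induced_merge ..

lemma answers_merge: "answers sim S D E V q x y = answers sim (valued S) D {} (merge D E V) q x y"
  unfolding answers_def sat_merge ..

text \<open>The positions need not hold \<open>c\<close> and \<open>c'\<close> themselves;
  equivalent objects suffice, because joining two classes does not depend on the
  representatives.\<close>

lemma merge_join_objects:
  assumes p: "p \<in> Positions D" "p' \<in> Positions D" and c: "(const_at D p, c) \<in> E" "(const_at D p', c') \<in> E"
  shows "merge D (EqRel (E \<union> {(c, c')}) (Objs S D)) V = EqRel (merge D E V \<union> {(p, p')}) (Positions D)"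
proof -
  have symE: "\<And>x y. (x, y) \<in> E \<Longrightarrow> (y, x) \<in> E" "\<And>x y z. (x, y) \<in> E \<Longrightarrow> (y, z) \<in> E \<Longrightarrow> (x, z) \<in> E"
    using E unfolding equiv_def sym_def trans_def by blast+
  have obj: "const_at D p \<in> Objs S D" "const_at D p' \<in> Objs S D" "c \<in> Objs S D" "c' \<in> Objs S D"
    using E_D c by blast+
  have cE: "(x, c) \<in> E \<longleftrightarrow> (x, const_at D p) \<in> E" "(c, x) \<in> E \<longleftrightarrow> (const_at D p, x) \<in> E"
    "(x, c') \<in> E \<longleftrightarrow> (x, const_at D p') \<in> E" "(c', x) \<in> E \<longleftrightarrow> (const_at D p', x) \<in> E" for x
    using c symE by blast+
  have "EqRel (merge D E V \<union> {(p, p')}) (Positions D) = merge D E V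
      \<union> {(x, y). (x \<in> Positions D \<and> (const_at D x, c) \<in> E) \<and> y \<in> Positions D \<and> (c', const_at D y) \<in> E}
      \<union> {(x, y). (x \<in> Positions D \<and> (const_at D x, c') \<in> E) \<and> y \<in> Positions D \<and> (c, const_at D y) \<in> E}"
    unfolding EqRel_join[OF equiv_merge p] cE
    using merge_Objs1[OF obj(1) p(1)] merge_Objs2[OF obj(1) p(1)]
      merge_Objs1[OF obj(2) p(2)] merge_Objs2[OF obj(2) p(2)] by simp
  then show ?thesis
    unfolding EqRel_join[OF E obj(3,4)] by (auto simp: merge_def pos_rel_def)
qed

lemma merge_join_cells:
  assumes "p \<in> Cells S D" "p' \<in> Cells S D"
  shows "merge D E (EqRel (V \<union> {(p, p')}) (Cells S D)) = EqRel (merge D E V \<union> {(p, p')}) (Positions D)"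
  unfolding EqRel_join[OF V assms] EqRel_join[OF equiv_merge assms[THEN Cells_Positions]]
    merge_Cells1[OF assms(1)] merge_Cells1[OF assms(2)] merge_Cells2[OF assms(1)] merge_Cells2[OF assms(2)]
  unfolding merge_def by blast

end

text \<open>The image of the original initial candidate is coarser than the identity on positions;
  this equation tells which pairs have to be derived to reach it.\<close>

lemma merge_Id: "merge D (Id_on (Objs S D)) (Id_on (Cells S D)) =
  EqRel (pos_rel D (Id_on (Objs S D))) (Positions D)"
proof -
  have "EqRel (pos_rel D (Id_on (Objs S D))) (Positions D) = merge D (Id_on (Objs S D)) (Id_on (Cells S D))"
  proof (rule EqRel_eqI)
    show "merge D (Id_on (Objs S D)) (Id_on (Cells S D)) \<subseteq> r"
      if "equiv (Positions D) r" "pos_rel D (Id_on (Objs S D)) \<subseteq> r" for r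
      using that Cells_Positions unfolding merge_def equiv_def refl_on_def by auto
  qed (auto simp: merge_def intro: equiv_merge[OF equiv_Id_on equiv_Id_on, unfolded merge_def])
  then show ?thesis ..
qed

end


section \<open>Rules for the all-value schema\<close>

text \<open>The parameter \<open>P\<close> allows one notion for both kinds of new rules: the
  answers of an object rule, or \<open>Id\<close> for the equality rules. The database is quantified
  inside, so that a rule can be chosen before any database is given.\<close>

definition links ::
  "('s \<Rightarrow> ('o, 'v, 't) const rel) \<Rightarrow> 'r schema \<Rightarrow> ('r, 's, 'o, 'v, 't) vrule \<Rightarrow> 'r \<Rightarrow> nat \<Rightarrow> 'r \<Rightarrow> nat
    \<Rightarrow> (('r, 'o, 'v, 't) fact set \<Rightarrow> ('o, 'v, 't) cell rel \<Rightarrow> ('o, 'v, 't) const rel) \<Rightarrow> bool" where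
  "links sim S r R i R' j P \<longleftrightarrow> obj_pos S R i \<and> obj_pos S R' j \<and>
     (\<exists>q x y. r = VRule q x i y j \<and> wf_vrule (valued S) r \<and>
       (\<forall>D W t t'. database std_carrier S D \<longrightarrow> equiv (Positions D) W \<longrightarrow>
         ((t, t') \<in> answers sim (valued S) D {} W q x y \<longleftrightarrow>
           (\<exists>cs cs' c c'. (R, cs) \<in> D \<and> t = cs ! 0 \<and> (R', cs') \<in> D \<and> t' = cs' ! 0 \<and>
              c \<in> block D W cs i \<and> c' \<in> block D W cs' j \<and> (c, c') \<in> P D W))))"

lemma links_E:
  assumes "links sim S r R i R' j P"
  obtains q x y where "r = VRule q x i y j" "obj_pos S R i" "obj_pos S R' j" "wf_vrule (valued S) r"
  using assms unfolding links_def by (elim exE conjE) (rule that)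

lemma wf_query_valued:
  assumes "wf_query S q"
  shows "wf_query (valued S) q"
  unfolding wf_query_def
proof
  fix p assume "p \<in> set (rels q)"
  moreover obtain R us where "p = (R, us)" by fastforce
  moreover from calculation obtain ts where "S R = Some ts" "length us = Suc (length ts)"
    using assms unfolding wf_query_def by blast
  ultimately show "case p of (R, us) \<Rightarrow> \<exists>ts. valued S R = Some ts \<and> length us = Suc (length ts)"
    by (simp add: valued_def)
qed

text \<open>Both kinds of new rules arise from this construction: \<open>a\<close>, \<open>b\<close>
  are the free variables of an object rule, or \<open>a = b\<close> makes the two linking atoms
  share a variable.\<close>

lemma ex_links:
  fixes sim :: "'s \<Rightarrow> ('o, 'v, 't) const rel" and q :: "('r, 's, 'o, 'v, 't) query"
  assumes q: "wf_query S q" "ineqs q = []" "Var a \<notin> sim_terms q" "Var b \<notin> sim_terms q"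
    and ij: "obj_pos S R i" "obj_pos S R' j"
  shows "\<exists>r. links sim S r R i R' j
    (\<lambda>D W. {(c, c'). (a = b \<longrightarrow> c = c') \<and> sat sim (valued S) D {} W (subst [a \<mapsto> c, b \<mapsto> c'] q)})"
proof -
  obtain m where m: "fresh_for m q" "a < m" "b < m" using ex_fresh_for by blast
  obtain ts where ts: "S R = Some ts" "1 \<le> i" "i \<le> length ts" using ij(1) unfolding obj_pos_def by blast
  obtain ts' where ts': "S R' = Some ts'" "1 \<le> j" "j \<le> length ts'" using ij(2) unfolding obj_pos_def by blast
  let ?N = "Suc (length ts)" and ?N' = "Suc (length ts')"
  let ?q = "extend q (link (Var m) R ?N i a m) (link (Var (Suc m)) R' ?N' j b (Suc m))"
  have fresh: "(n, k) \<notin> occs q (Var z)" if "m \<le> z" for n k z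
    using that m(1) occs_in_terms[of n k q "Var z"] unfolding fresh_for_def by auto
  have fresh_sim: "Var z \<notin> sim_terms q" if "m \<le> z" for z
    using that m(1) sim_terms_subset[of q] unfolding fresh_for_def by fastforce
  have occs: "(n, k) \<in> occs ?q u \<longleftrightarrow> (n, k) \<in> occs q u
      \<or> n = length (rels q) \<and> k < ?N \<and> (if k = 0 then Var m else Var (if k = i then a else m + 2 * k)) = u
      \<or> n = Suc (length (rels q)) \<and> k < ?N' \<and>
        (if k = 0 then Var (Suc m) else Var (if k = j then b else Suc m + 2 * k)) = u" for n k u
    unfolding occs_extend using nth_link[of k ?N "Var m" R i a m] nth_link[of k ?N' "Var (Suc m)" R' j b "Suc m"]
    by auto
  \<comment> \<open>A value rule needs tid variables with exactly one occurrence each; this is what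
    the new atoms are for.\<close>
  have "occs ?q (Var m) = {(length (rels q), 0)}" "occs ?q (Var (Suc m)) = {(Suc (length (rels q)), 0)}"
    using m(2,3) fresh by (auto simp: occs split: if_splits)
  then have tid: "once_as_tid (valued S) ?q m i" "once_as_tid (valued S) ?q (Suc m) j"
    using ts ts' fresh_sim unfolding once_as_tid_def
    by (auto simp: rels_extend_nth val_pos_def valued_def)
  have "wf_query (valued S) ?q"
    using wf_query_valued[OF q(1)] ts(1) ts'(1) unfolding wf_query_def
    using ts(2,3) ts'(2,3) by (simp add: extend_def link_def valued_def) arith
  then have wf: "wf_vrule (valued S) (VRule ?q m i (Suc m) j)" using tid by simp
  have "(t, t') \<in> answers sim (valued S) D {} W ?q m (Suc m) \<longleftrightarrow>
      (\<exists>cs cs' c c'. (R, cs) \<in> D \<and> t = cs ! 0 \<and> (R', cs') \<in> D \<and> t' = cs' ! 0 \<and>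
        c \<in> block D W cs i \<and> c' \<in> block D W cs' j \<and> (a = b \<longrightarrow> c = c') \<and>
        sat sim (valued S) D {} W (subst [a \<mapsto> c, b \<mapsto> c'] q))"
    if db: "database std_carrier S D" and W: "equiv (Positions D) W" for D W t t'
  proof -
    have N: "\<And>cs. (R, cs) \<in> D \<Longrightarrow> length cs = ?N" "\<And>cs. (R', cs) \<in> D \<Longrightarrow> length cs = ?N'"
      using ts ts' by (metis database_entry[OF db] option.inject)+
    have "(t, t') \<in> answers sim (valued S) D {} W ?q m (Suc m) \<longleftrightarrow>
      (\<exists>f. match sim D W (extend q (link (Const t) R ?N i a m) (link (Const t') R' ?N' j b (Suc m))) f)"
      unfolding answers_def by (simp add: subst_extend_link m q(2) sat_iff_match[OF db W])
    then show ?thesis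
      unfolding sat_iff_match[OF db W] using ts(2,3) ts'(2,3)
      by (subst (asm) ex_match_extend_iff[OF db W m q(2-4) _ _ _ _ N]) auto
  qed
  then have "links sim S (VRule ?q m i (Suc m) j) R i R' j
    (\<lambda>D W. {(c, c'). (a = b \<longrightarrow> c = c') \<and> sat sim (valued S) D {} W (subst [a \<mapsto> c, b \<mapsto> c'] q)})"
    unfolding links_def using ij wf by auto
  then show ?thesis by blast
qed

text \<open>The empty query is always satisfied. Extended by two linking atoms with a common
  variable, it holds exactly when the two blocks intersect.\<close>

lemma ex_links_equal:
  fixes sim :: "'s \<Rightarrow> ('o, 'v, 't) const rel"
  assumes "obj_pos S R i" "obj_pos S R' j"
  shows "\<exists>r. links sim S r R i R' j (\<lambda>D W. Id)"
proof -
  let ?q = "Query [] [] [] :: ('a, 's, 'o, 'v, 't) query"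
  have "sat sim T D {} W (subst \<sigma> ?q)" for T :: "'a schema" and D W \<sigma>
    by (simp add: sat_def subst_def terms_def)
  then have "{(c, c'). (0 = (0::nat) \<longrightarrow> c = c') \<and> sat sim T D {} W (subst [0 \<mapsto> c, 0 \<mapsto> c'] ?q)} = Id"
    for T :: "'a schema" and D W by auto
  then show ?thesis
    using ex_links[of S ?q 0 0 R i R' j sim] assms by (simp add: wf_query_def sim_terms_def)
qed

text \<open>Any occurrences of \<open>x\<close> and \<open>y\<close> will do, but they have to be
  occurrences: only then does a match of \<open>q\<close> itself provide facts for the linking
  atoms, so that no answer is lost.\<close>

fun orule_links ::
  "('s \<Rightarrow> ('o, 'v, 't) const rel) \<Rightarrow> 'r schema \<Rightarrow> ('r, 's, 'o, 'v, 't) orule \<Rightarrow> ('r, 's, 'o, 'v, 't) vrule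
    \<Rightarrow> bool" where
  "orule_links sim S (ORule q x y) r' \<longleftrightarrow> (\<exists>n n' i j.
     (n, i) \<in> occs q (Var x) \<and> (n', j) \<in> occs q (Var y) \<and>
     links sim S r' (fst (rels q ! n)) i (fst (rels q ! n')) j (\<lambda>D W. answers sim (valued S) D {} W q x y))"

lemma ex_orule_links:
  assumes "wf_orule S r"
  shows "\<exists>r'. orule_links sim S r r'"
proof -
  obtain q x y where r: "r = ORule q x y" by (cases r)
  have wf: "wf_query S q" "ineqs q = []" "x \<noteq> y" "only_obj_occs S q x" "only_obj_occs S q y"
    using assms r by auto
  obtain n i n' j where o: "(n, i) \<in> occs q (Var x)" "(n', j) \<in> occs q (Var y)"
    using wf unfolding only_obj_occs_def by auto
  then have "obj_pos S (fst (rels q ! n)) i" "obj_pos S (fst (rels q ! n')) j"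
    using wf unfolding only_obj_occs_def by auto
  then obtain r' where "links sim S r' (fst (rels q ! n)) i (fst (rels q ! n')) j
    (\<lambda>D W. {(c, c'). (x = y \<longrightarrow> c = c') \<and> sat sim (valued S) D {} W (subst [x \<mapsto> c, y \<mapsto> c'] q)})"
    using ex_links[of S q x y] wf unfolding only_obj_occs_def by blast
  then have "links sim S r' (fst (rels q ! n)) i (fst (rels q ! n')) j
    (\<lambda>D W. answers sim (valued S) D {} W q x y)"
    using wf(3) by (simp add: answers_def)
  then show ?thesis using r o unfolding r orule_links.simps by blast
qed

text \<open>The block at position 0 is a singleton, so an answer consists of actual tids of facts
  over the relations named in the rule. Typing by \<open>T\<close> is separate from evaluation, as
  the lemma serves both the original and the all-value schema.\<close>

lemma vrule_answer_Cells:
  assumes db: "database C T D" and W: "equiv (Positions D) W" and wf: "wf_vrule T (VRule q x i y j)"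
    and ans: "(t, t') \<in> answers sim (valued U) D {} W q x y"
  shows "(t, i) \<in> Cells T D" "(t', j) \<in> Cells T D"
proof -
  have sat: "sat sim (valued U) D {} W (subst [x \<mapsto> t, y \<mapsto> t'] q)"
    using ans unfolding answers_def by simp
  have "(s, k) \<in> Cells T D" if z: "once_as_tid T q z k" "[x \<mapsto> t, y \<mapsto> t'] z = Some s" for z k s
  proof -
    obtain n where n: "occs q (Var z) = {(n, 0)}" "val_pos T (fst (rels q ! n)) k"
      using z(1) unfolding once_as_tid_def by blast
    then obtain cs where "(fst (rels q ! n), cs) \<in> D" "s \<in> block D W cs 0"
      using sat_subst_occurrence[OF db W sat z(2), where k=0] by blast
    then show ?thesis using n(2) unfolding Cells_def block_def by auto
  qed
  then show "(t, i) \<in> Cells T D" "(t', j) \<in> Cells T D" using wf by auto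
qed

lemma finite_Positions: "finite D \<Longrightarrow> finite (Positions D)"
proof -
  assume "finite D"
  then have "finite (\<Union>(R, cs) \<in> D. {cs ! 0} \<times> {..<length cs})" by auto
  then show ?thesis by (rule rev_finite_subset) (auto simp: Positions_def)
qed

lemma obj_pos_less_length:
  assumes "database C S D" "(R, cs) \<in> D" "obj_pos S R k"
  shows "k < length cs"
proof -
  obtain ts where "S R = Some ts" "length cs = Suc (length ts)"
    using database_entry[OF assms(1,2)] by metis
  then show ?thesis using assms(3) unfolding obj_pos_def by auto
qed


section \<open>Correspondence of solutions\<close>

text \<open>The database is fixed here, but \<open>\<Sigma>'\<close>, \<open>T\<close> and
  \<open>I\<close> are later constructed without reference to it; the assumptions state what that
  construction guarantees.\<close>

locale simulation =
  fixes sim :: "'s \<Rightarrow> ('o, 'v, 't) const rel" and S :: "'r schema" and D :: "('r, 'o, 'v, 't) fact set"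
    and \<Sigma> \<Sigma>' :: "('r, 's, 'o, 'v, 't) spec" and T I
  assumes db: "database std_carrier S D"
    and spec: "er_spec S \<Sigma>" and spec': "er_spec (valued S) \<Sigma>'"
    and no_orules: "hard_o \<Sigma>' = {}" "soft_o \<Sigma>' = {}"
    and hard_v: "hard_v \<Sigma>' = hard_v \<Sigma> \<union> T ` hard_o \<Sigma> \<union> I"
    and soft_v: "soft_v \<Sigma>' = soft_v \<Sigma> \<union> T ` soft_o \<Sigma>"
    and denials: "denials \<Sigma>' = denials \<Sigma>"
    and T: "\<And>r. r \<in> hard_o \<Sigma> \<union> soft_o \<Sigma> \<Longrightarrow> orule_links sim S r (T r)"
    and I: "\<And>r. r \<in> I \<Longrightarrow> \<exists>R i R' j. links sim S r R i R' j (\<lambda>D W. Id)"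
    and I_all: "\<And>R i R' j. obj_pos S R i \<Longrightarrow> obj_pos S R' j \<Longrightarrow> \<exists>r \<in> I. links sim S r R i R' j (\<lambda>D W. Id)"
begin

section \<open>Soundness: derivations replayed in the original specification\<close>

lemma wf_rules:
  "r \<in> hard_o \<Sigma> \<union> soft_o \<Sigma> \<Longrightarrow> wf_orule S r" "r' \<in> hard_v \<Sigma> \<union> soft_v \<Sigma> \<Longrightarrow> wf_vrule S r'"
  "r' \<in> hard_v \<Sigma>' \<union> soft_v \<Sigma>' \<Longrightarrow> wf_vrule (valued S) r'"
  using spec spec' unfolding er_spec_def by blast+

lemma links_answer:
  assumes "links sim S (VRule q x i y j) R i R' j P" "equiv (Positions D) W"
    "(R, cs) \<in> D" "(R', cs') \<in> D" "c \<in> block D W cs i" "c' \<in> block D W cs' j" "(c, c') \<in> P D W"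
  shows "(cs ! 0, cs' ! 0) \<in> answers sim (valued S) D {} W q x y"
  using assms db unfolding links_def by auto

lemma links_merge:
  assumes "links sim S (VRule q x i y j) R i0 R' j0 P" and E: "equiv (Objs S D) E" and V: "equiv (Cells S D) V"
    and "(t, t') \<in> answers sim (valued S) D {} (merge D E V) q x y"
  obtains c c' where "(t, i) \<in> Positions D" "(t', j) \<in> Positions D"
    "(const_at D (t, i), c) \<in> E" "(const_at D (t', j), c') \<in> E" "(c, c') \<in> P D (merge D E V)"
proof -
  have o: "obj_pos S R i" "obj_pos S R' j" using assms(1) by (auto elim: links_E)
  obtain cs cs' c c' where *: "(R, cs) \<in> D" "t = cs ! 0" "(R', cs') \<in> D" "t' = cs' ! 0"
    "c \<in> block D (merge D E V) cs i" "c' \<in> block D (merge D E V) cs' j" "(c, c') \<in> P D (merge D E V)"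
    using assms(1,4) db equiv_merge[OF db E V] unfolding links_def by auto
  show thesis
    using that[of c c'] * obj_pos_const_at[OF db *(1) o(1)] obj_pos_const_at[OF db *(3) o(2)]
    unfolding block_merge[OF db E V *(1) o(1)] block_merge[OF db E V *(3) o(2)] by simp
qed

text \<open>The facts that match the atoms of \<open>q\<close> containing \<open>x\<close> and
  \<open>y\<close> also match the linking atoms. Their blocks are \<open>E\<close>-classes, so the
  stored objects are equivalent to \<open>c\<close> and \<open>c'\<close>, though possibly different
  from them.\<close>

lemma orule_answer:
  assumes E: "equiv (Objs S D) E" and V: "equiv (Cells S D) V"
    and r: "ORule q x y \<in> hard_o \<Sigma> \<union> soft_o \<Sigma>" and ans: "(c, c') \<in> answers sim S D E V q x y"
  obtains q' x' i y' j t t' where "T (ORule q x y) = VRule q' x' i y' j"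
    "(t, t') \<in> answers sim (valued S) D {} (merge D E V) q' x' y'"
    "(t, i) \<in> Positions D" "(t', j) \<in> Positions D"
    "(const_at D (t, i), c) \<in> E" "(const_at D (t', j), c') \<in> E"
proof -
  let ?W = "merge D E V"
  note W = equiv_merge[OF db E V]
  obtain n n' i j where l: "(n, i) \<in> occs q (Var x)" "(n', j) \<in> occs q (Var y)"
     "links sim S (T (ORule q x y)) (fst (rels q ! n)) i (fst (rels q ! n')) j
       (\<lambda>D W. answers sim (valued S) D {} W q x y)" (is "links _ _ _ ?R _ ?R' _ _")
    using T[OF r] unfolding orule_links.simps by (elim exE conjE) (rule that)
  then obtain q' x' y' where q': "T (ORule q x y) = VRule q' x' i y' j" and o: "obj_pos S ?R i" "obj_pos S ?R' j"
    by (elim links_E) (rule that)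
  have ans': "(c, c') \<in> answers sim (valued S) D {} ?W q x y" using ans answers_merge[OF db E V] by blast
  then have sat: "sat sim (valued S) D {} ?W (subst [x \<mapsto> c, y \<mapsto> c'] q)" unfolding answers_def by simp
  have "x \<noteq> y" using wf_rules(1)[OF r] by simp
  then obtain cs where cs: "(?R, cs) \<in> D" "c \<in> block D ?W cs i"
    using sat_subst_occurrence[OF db W sat _ l(1), where c=c] by auto
  obtain cs' where cs': "(?R', cs') \<in> D" "c' \<in> block D ?W cs' j"
    using sat_subst_occurrence[OF db W sat _ l(2), where c=c'] by auto
  have "(cs ! 0, cs' ! 0) \<in> answers sim (valued S) D {} ?W q' x' y'"
    using links_answer[OF l(3)[unfolded q'] W cs(1) cs'(1) cs(2) cs'(2) ans'] .
  then show thesis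
    using that[OF q'] cs(2) cs'(2) obj_pos_const_at[OF db cs(1) o(1)] obj_pos_const_at[OF db cs'(1) o(2)]
    unfolding block_merge[OF db E V cs(1) o(1)] block_merge[OF db E V cs'(1) o(2)] by simp
qed

lemma vrule_answer:
  assumes E: "equiv (Objs S D) E" and V: "equiv (Cells S D) V"
    and r: "VRule q x i y j \<in> hard_v \<Sigma> \<union> soft_v \<Sigma>" and ans: "(t, t') \<in> answers sim S D E V q x y"
  shows "(t, i) \<in> Cells S D" "(t', j) \<in> Cells S D"
  using vrule_answer_Cells[OF db equiv_merge[OF db E V] wf_rules(2)[OF r]] ans answers_merge[OF db E V] by blast+

text \<open>\<open>EqRel\<close> behaves well only for pairs inside its carrier, so each answer is
  first located there: for objects through its \<open>E\<close>-class, for cells through the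
  tids.\<close>

lemma candidate_equiv:
  assumes "candidate sim S D \<Sigma> E V"
  shows "equiv (Objs S D) E \<and> equiv (Cells S D) V"
  using assms
proof induction
  case init
  show ?case by (simp add: equiv_EqRel)
next
  case (obj E V q x y c c')
  then have E: "equiv (Objs S D) E" "equiv (Cells S D) V" by auto
  have "(c, c') \<in> Objs S D \<times> Objs S D"
    by (rule orule_answer[OF E obj(2,3)]) (use E_D[OF db E] in blast)
  then have "E \<union> {(c, c')} \<subseteq> Objs S D \<times> Objs S D" using E(1) by (auto simp: equiv_def)
  then show ?case using E(2) by (simp add: equiv_EqRel)
next
  case (val E V q x i y j t t')
  then have E: "equiv (Objs S D) E" "equiv (Cells S D) V" by auto
  have "V \<union> {((t, i), (t', j))} \<subseteq> Cells S D \<times> Cells S D"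
    using vrule_answer[OF E val(2,3)] E(2) by (auto simp: equiv_def)
  then show ?case using E(1) by (simp add: equiv_EqRel)
qed

text \<open>Equality \<open>W = merge D E V\<close> fails for candidates that do not yet identify all positions with
  equal objects; the condition on \<open>X\<close> says that these are the only pairs missing from \<open>W\<close>.\<close>

lemma candidate_sound:
  assumes "candidate sim (valued S) D \<Sigma>' E0 W"
  shows "E0 = {} \<and> equiv (Positions D) W \<and> (\<exists>E V. candidate sim S D \<Sigma> E V \<and> W \<subseteq> merge D E V \<and>
    (\<forall>X. equiv (Positions D) X \<longrightarrow> W \<subseteq> X \<longrightarrow> pos_rel D (Id_on (Objs S D)) \<subseteq> X \<longrightarrow> merge D E V \<subseteq> X))"
  using assms
proof induction
  case init
  have "candidate sim S D \<Sigma> (Id_on (Objs S D)) (Id_on (Cells S D))"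
    using candidate.init[of sim S D \<Sigma>] by (simp add: EqRel_empty)
  moreover
  have "equiv (Positions D) (merge D (Id_on (Objs S D)) (Id_on (Cells S D)))"
    by (rule equiv_merge[OF db equiv_Id_on equiv_Id_on])
  then have "Id_on (Positions D) \<subseteq> merge D (Id_on (Objs S D)) (Id_on (Cells S D))"
    by (auto simp: equiv_def refl_on_def)
  moreover have "merge D (Id_on (Objs S D)) (Id_on (Cells S D)) \<subseteq> X"
    if "equiv (Positions D) X" "pos_rel D (Id_on (Objs S D)) \<subseteq> X" for X
    unfolding merge_Id[OF db] using that by (rule EqRel_least)
  ultimately have "\<exists>E V. candidate sim S D \<Sigma> E V \<and> Id_on (Positions D) \<subseteq> merge D E V \<and>
    (\<forall>X. equiv (Positions D) X \<longrightarrow> Id_on (Positions D) \<subseteq> X \<longrightarrow> pos_rel D (Id_on (Objs S D)) \<subseteq> X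
      \<longrightarrow> merge D E V \<subseteq> X)" by blast
  then show ?case
    unfolding EqRel_empty Objs_valued Cells_valued[OF db] using equiv_Id_on[of "Positions D"] by simp
next
  case (obj E W q x y c c')
  then show ?case using no_orules by simp
next
  case (val E0 W q x i y j t t')
  let ?p = "(t, i)" and ?p' = "(t', j)"
  obtain E V where EV: "E0 = {}" "equiv (Positions D) W" "candidate sim S D \<Sigma> E V" "W \<subseteq> merge D E V"
    "\<And>X. equiv (Positions D) X \<Longrightarrow> W \<subseteq> X \<Longrightarrow> pos_rel D (Id_on (Objs S D)) \<subseteq> X \<Longrightarrow> merge D E V \<subseteq> X"
    using val.IH by blast
  have E: "equiv (Objs S D) E" "equiv (Cells S D) V" using candidate_equiv[OF EV(3)] by auto
  note M = equiv_merge[OF db E]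
  have wf: "wf_vrule (valued S) (VRule q x i y j)" using wf_rules(3)[OF val(2)] .
  have ans0: "(t, t') \<in> answers sim (valued S) D {} W q x y" using val(3) EV(1) by simp
  have p: "?p \<in> Positions D" "?p' \<in> Positions D"
    using vrule_answer_Cells[OF database_valued[OF db] EV(2) wf ans0] Cells_valued[OF db] by auto
  \<comment> \<open>The replayed rule is evaluated over a relation that may be coarser than
    \<open>W\<close>; monotonicity preserves the answer.\<close>
  have ans: "(t, t') \<in> answers sim (valued S) D {} (merge D E V) q x y"
    by (rule subsetD[OF answers_mono[OF db EV(2) M EV(4)] ans0]) (use wf in simp)
  let ?W = "EqRel (W \<union> {(?p, ?p')}) (Positions D)"
  have W': "W \<union> {(?p, ?p')} \<subseteq> Positions D \<times> Positions D" using EV(2) p by (auto simp: equiv_def)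
  have "merge D E V \<union> {(?p, ?p')} \<subseteq> Positions D \<times> Positions D" using M p by (auto simp: equiv_def)
  note M' = equiv_EqRel[OF this]
  \<comment> \<open>This reduces each kind of rule to one task: find an original candidate whose
    merge arises by joining the two positions. The lower bound follows because every admissible
    \<open>X\<close> contains \<open>W\<close> and the new pair, hence the old merge and the
    closure.\<close>
  have step: ?case if E': "candidate sim S D \<Sigma> E' V'"
    "merge D E' V' = EqRel (merge D E V \<union> {(?p, ?p')}) (Positions D)" for E' V'
  proof -
    have "?W \<subseteq> merge D E' V'" unfolding E'(2)
      using EV(4) EqRel_superset[of "merge D E V \<union> {(?p, ?p')}"] by (intro EqRel_least M') blast
    moreover have "merge D E' V' \<subseteq> X"
      if "equiv (Positions D) X" "?W \<subseteq> X" "pos_rel D (Id_on (Objs S D)) \<subseteq> X" for X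
    proof -
      have "W \<union> {(?p, ?p')} \<subseteq> X" using EqRel_superset that(2) by (rule subset_trans)
      then show ?thesis unfolding E'(2) using EV(5)[OF that(1) _ that(3)] that(1) by (intro EqRel_least) auto
    qed
    ultimately show ?thesis using E'(1) EV(1) equiv_EqRel[OF W'] unfolding Cells_valued[OF db] by blast
  qed
  consider "VRule q x i y j \<in> hard_v \<Sigma> \<union> soft_v \<Sigma>"
    | r where "r \<in> hard_o \<Sigma> \<union> soft_o \<Sigma>" "VRule q x i y j = T r" | "VRule q x i y j \<in> I"
    using val(2) unfolding hard_v soft_v by blast
  then show ?case
  proof cases
    case 1
    have a: "(t, t') \<in> answers sim S D E V q x y" using ans answers_merge[OF db E] by blast
    show ?thesis
      using step[OF candidate.val[OF EV(3) 1 a]] merge_join_cells[OF db E vrule_answer[OF E 1 a]] by blast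
  next
    case 2
    obtain qo xo yo where ro: "r = ORule qo xo yo" by (cases r)
    have "orule_links sim S (ORule qo xo yo) (VRule q x i y j)" using T[OF 2(1)] 2(2) ro by simp
    then obtain R i0 R' j0 where l:
      "links sim S (VRule q x i y j) R i0 R' j0 (\<lambda>D W. answers sim (valued S) D {} W qo xo yo)"
      unfolding orule_links.simps by (elim exE conjE) (rule that)
    obtain c c' where c: "(const_at D ?p, c) \<in> E" "(const_at D ?p', c') \<in> E"
      "(c, c') \<in> answers sim S D E V qo xo yo"
      by (rule links_merge[OF l E ans]) (use answers_merge[OF db E] in blast)
    show ?thesis
      using step[OF candidate.obj[OF EV(3) _ c(3)]] 2(1) merge_join_objects[OF db E p c(1,2)] ro by blast
  next
    \<comment> \<open>Intersecting \<open>E\<close>-classes are equal, so the pair already belongs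
      to the merge and the original derivation stands still.\<close>
    case 3
    then obtain R i0 R' j0 where l: "links sim S (VRule q x i y j) R i0 R' j0 (\<lambda>D W. Id)" using I by blast
    have "trans E" "sym E" using E(1) by (auto simp: equiv_def)
    then have "(const_at D ?p, const_at D ?p') \<in> E"
      by - (rule links_merge[OF l E ans], simp, meson symD transD)
    then have "(?p, ?p') \<in> merge D E V" using p unfolding merge_def pos_rel_def by auto
    then have "merge D E V \<union> {(?p, ?p')} = merge D E V" by blast
    moreover have "EqRel (merge D E V) (Positions D) = merge D E V" using M by (intro EqRel_eqI) auto
    ultimately show ?thesis using step[OF EV(3)] by simp
  qed
qed

section \<open>Completeness: derivations carried over to the all-value schema\<close>

lemma candidate_val':
  assumes "candidate sim (valued S) D \<Sigma>' {} W" "VRule q x i y j \<in> hard_v \<Sigma>' \<union> soft_v \<Sigma>'"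
    "(t, t') \<in> answers sim (valued S) D {} W q x y"
  shows "candidate sim (valued S) D \<Sigma>' {} (EqRel (W \<union> {((t, i), (t', j))}) (Positions D))"
  using candidate.val[OF assms] unfolding Cells_valued[OF db] .

text \<open>A block always contains its own constant, so positions holding the same object have
  intersecting blocks over every \<open>W\<close>. The equality rules can thus fire at any time, and
  a relation closed under them contains all these pairs.\<close>

lemma pos_rel_Id_answer:
  assumes W: "equiv (Positions D) W" and pp': "(p, p') \<in> pos_rel D (Id_on (Objs S D))"
  obtains q x y where "VRule q x (snd p) y (snd p') \<in> I"
    "(fst p, fst p') \<in> answers sim (valued S) D {} W q x y"
proof -
  have p: "p \<in> Positions D" "p' \<in> Positions D" "const_at D p = const_at D p'" "const_at D p \<in> Objs S D"
    using pp' unfolding pos_rel_def by auto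
  have nc: "p \<notin> Cells S D" "p' \<notin> Cells S D" using const_at_Cells[OF db] p(3,4) by metis+
  obtain R cs i where 1: "p = (cs ! 0, i)" "(R, cs) \<in> D" "obj_pos S R i"
    using p(1) by (rule Positions_cases[OF db]) (simp add: nc, rule that)
  obtain R' cs' j where 2: "p' = (cs' ! 0, j)" "(R', cs') \<in> D" "obj_pos S R' j"
    using p(2) by (rule Positions_cases[OF db]) (simp add: nc, rule that)
  obtain r where r: "r \<in> I" "links sim S r R i R' j (\<lambda>D W. Id)" using I_all[OF 1(3) 2(3)] by blast
  then obtain q x y where q: "r = VRule q x i y j" by (elim links_E)
  have eq: "cs ! i = cs' ! j"
    using p(3) obj_pos_const_at(2)[OF db 1(2,3)] obj_pos_const_at(2)[OF db 2(2,3)] 1(1) 2(1) by simp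
  have "cs ! i \<in> block D W cs i" "cs' ! j \<in> block D W cs' j"
    using nth_in_block[OF db W] obj_pos_less_length[OF db] 1 2 by blast+
  then have "(cs ! 0, cs' ! 0) \<in> answers sim (valued S) D {} W q x y"
    using links_answer[OF r(2)[unfolded q] W 1(2) 2(2)] eq by auto
  then show thesis using that[of q x y] r(1) q 1(1) 2(1) by simp
qed

text \<open>Only the start takes several steps: the equality rules must first generate
  \<open>pos_rel\<close> of the identity, which is finite as \<open>D\<close> is. Afterwards each
  original step corresponds to one step.\<close>

lemma candidate_complete:
  assumes "candidate sim S D \<Sigma> E V"
  shows "candidate sim (valued S) D \<Sigma>' {} (merge D E V)"
  using assms
proof induction
  case init
  have sub: "pos_rel D (Id_on (Objs S D)) \<subseteq> Positions D \<times> Positions D"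
    unfolding pos_rel_def by auto
  have "candidate sim (valued S) D \<Sigma>' {} (EqRel P (Positions D))"
    if "finite P" "P \<subseteq> pos_rel D (Id_on (Objs S D))" for P
    using that
  proof (induction P rule: finite_induct)
    case empty
    show ?case using candidate.init[of sim "valued S" D \<Sigma>']
      by (simp add: Objs_valued Cells_valued[OF db] EqRel_empty)
  next
    case (insert pp P)
    obtain p p' where pp: "pp = (p, p')" by (cases pp)
    then have pr: "(p, p') \<in> pos_rel D (Id_on (Objs S D))" using insert.prems by blast
    have W: "equiv (Positions D) (EqRel P (Positions D))"
      using insert.prems sub by (intro equiv_EqRel) blast
    obtain q x y where q: "VRule q x (snd p) y (snd p') \<in> I"
      "(fst p, fst p') \<in> answers sim (valued S) D {} (EqRel P (Positions D)) q x y"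
      by (rule pos_rel_Id_answer[OF W pr])
    have "candidate sim (valued S) D \<Sigma>' {} (EqRel (EqRel P (Positions D) \<union> {pp}) (Positions D))"
      using candidate_val'[of "EqRel P (Positions D)" q x "snd p" y "snd p'", OF _ _ q(2)] q(1) insert pp
      unfolding hard_v by simp
    then show ?case
      using EqRel_insert_EqRel[OF subset_trans[OF insert.prems sub]] by simp
  qed
  moreover have "finite (pos_rel D (Id_on (Objs S D)))"
    using finite_Positions[of D] db finite_subset[OF sub] unfolding database_def by simp
  ultimately show ?case unfolding EqRel_empty merge_Id[OF db] by blast
next
  case (obj E V q x y c c')
  have E: "equiv (Objs S D) E" "equiv (Cells S D) V" using candidate_equiv[OF obj(1)] by auto
  obtain q' x' i y' j t t' where *: "T (ORule q x y) = VRule q' x' i y' j"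
    "(t, t') \<in> answers sim (valued S) D {} (merge D E V) q' x' y'"
    "(t, i) \<in> Positions D" "(t', j) \<in> Positions D"
    "(const_at D (t, i), c) \<in> E" "(const_at D (t', j), c') \<in> E"
    by (rule orule_answer[OF E obj(2,3)])
  have "VRule q' x' i y' j \<in> hard_v \<Sigma>' \<union> soft_v \<Sigma>'"
    using obj(2) unfolding hard_v soft_v *(1)[symmetric] by blast
  then show ?case
    using candidate_val'[OF obj.IH _ *(2)] merge_join_objects[OF db E *(3-6)] by simp
next
  case (val E V q x i y j t t')
  have E: "equiv (Objs S D) E" "equiv (Cells S D) V" using candidate_equiv[OF val(1)] by auto
  have "(t, t') \<in> answers sim (valued S) D {} (merge D E V) q x y" using val(3) answers_merge[OF db E] by blast
  moreover have "VRule q x i y j \<in> hard_v \<Sigma>' \<union> soft_v \<Sigma>'" using val(2) unfolding hard_v soft_v by blast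
  ultimately show ?case
    using candidate_val'[OF val.IH] merge_join_cells[OF db E vrule_answer[OF E val(2,3)]] by simp
qed

section \<open>Hard rules, denial constraints and solutions\<close>

definition hard_sat where
  "hard_sat E V \<longleftrightarrow> (\<forall>q x y. ORule q x y \<in> hard_o \<Sigma> \<longrightarrow> answers sim S D E V q x y \<subseteq> E) \<and>
     (\<forall>q x i y j. VRule q x i y j \<in> hard_v \<Sigma> \<longrightarrow>
        (\<forall>(t, t') \<in> answers sim S D E V q x y. ((t, i), (t', j)) \<in> V)) \<and>
     (\<forall>q \<in> denials \<Sigma>. \<not> sat sim S D E V q)"

definition hard_sat' where
  "hard_sat' W \<longleftrightarrow> (\<forall>q x i y j. VRule q x i y j \<in> hard_v \<Sigma>' \<longrightarrow>
        (\<forall>(t, t') \<in> answers sim (valued S) D {} W q x y. ((t, i), (t', j)) \<in> W)) \<and>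
     (\<forall>q \<in> denials \<Sigma>. \<not> sat sim (valued S) D {} W q)"

text \<open>The two induced databases coincide, which settles the denial constraints. For kept
  rules, \<open>merge D E V\<close> restricted to cells is \<open>V\<close>; for translated rules,
  it relates object positions exactly by \<open>E\<close>; the equality rules hold because
  intersecting \<open>E\<close>-classes coincide.\<close>

lemma hard_sat_merge:
  assumes E: "equiv (Objs S D) E" and V: "equiv (Cells S D) V"
  shows "hard_sat' (merge D E V) \<longleftrightarrow> hard_sat E V"
proof
  have tr: "\<And>x y z. (x, y) \<in> E \<Longrightarrow> (y, z) \<in> E \<Longrightarrow> (x, z) \<in> E" and sy: "\<And>x y. (x, y) \<in> E \<Longrightarrow> (y, x) \<in> E"
    using E unfolding equiv_def sym_def trans_def by blast+
  note M = equiv_merge[OF db E V]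
  {
    assume h: "hard_sat' (merge D E V)"
    have closed: "((t, i), (t', j)) \<in> merge D E V" if "VRule q x i y j \<in> hard_v \<Sigma>'"
      "(t, t') \<in> answers sim (valued S) D {} (merge D E V) q x y" for q x i y j t t'
      using h that unfolding hard_sat'_def by blast
    show "hard_sat E V"
      unfolding hard_sat_def
    proof (intro conjI allI impI ballI subrelI)
      fix q x y c c' assume r: "ORule q x y \<in> hard_o \<Sigma>" and ans: "(c, c') \<in> answers sim S D E V q x y"
      obtain q' x' i y' j t t' where *: "T (ORule q x y) = VRule q' x' i y' j"
        "(t, t') \<in> answers sim (valued S) D {} (merge D E V) q' x' y'"
        "(t, i) \<in> Positions D" "(t', j) \<in> Positions D"
        "(const_at D (t, i), c) \<in> E" "(const_at D (t', j), c') \<in> E"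
        by (rule orule_answer[OF E V _ ans]) (use r in blast)
      have "VRule q' x' i y' j \<in> hard_v \<Sigma>'" using r unfolding hard_v *(1)[symmetric] by blast
      then have "((t, i), (t', j)) \<in> merge D E V" using closed *(2) by blast
      moreover have "const_at D (t, i) \<in> Objs S D" using E_D[OF db E V] *(5) by blast
      ultimately have "(const_at D (t, i), const_at D (t', j)) \<in> E"
        using merge_Objs1[OF db E V] *(3) by blast
      then show "(c, c') \<in> E" using *(5,6) tr sy by meson
    next
      fix q x i y j p assume r: "VRule q x i y j \<in> hard_v \<Sigma>" and ans: "p \<in> answers sim S D E V q x y"
      obtain t t' where p: "p = (t, t')" by fastforce
      then have a: "(t, t') \<in> answers sim S D E V q x y" using ans by simp
      then have "((t, i), (t', j)) \<in> merge D E V"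
        using closed[of q x i y j t t'] r answers_merge[OF db E V] unfolding hard_v by blast
      moreover have "(t, i) \<in> Cells S D" using vrule_answer(1)[OF E V _ a] r by blast
      ultimately show "case p of (t, t') \<Rightarrow> ((t, i), (t', j)) \<in> V"
        using merge_Cells1[OF db E V] p by auto
    next
      fix q assume "q \<in> denials \<Sigma>"
      then show "\<not> sat sim S D E V q" using h sat_merge[OF db E V] unfolding hard_sat'_def by blast
    qed
  }
  assume h: "hard_sat E V"
  show "hard_sat' (merge D E V)"
    unfolding hard_sat'_def
  proof (intro conjI allI impI ballI)
    fix q x i y j p assume r: "VRule q x i y j \<in> hard_v \<Sigma>'"
      and ans: "p \<in> answers sim (valued S) D {} (merge D E V) q x y"
    obtain t t' where p: "p = (t, t')" by fastforce
    have ans: "(t, t') \<in> answers sim (valued S) D {} (merge D E V) q x y" using ans p by simp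
    \<comment> \<open>The bound \<open>E \<union> Id\<close> covers both kinds of new rules:
      satisfied object rules have answers in \<open>E\<close>, equality rules have \<open>P\<close>
      equal to \<open>Id\<close>.\<close>
    have linked: "((t, i), (t', j)) \<in> merge D E V"
      if l: "links sim S (VRule q x i y j) R i0 R' j0 P" "P D (merge D E V) \<subseteq> E \<union> Id" for R i0 R' j0 P
    proof -
      have "(t, i) \<in> Positions D \<and> (t', j) \<in> Positions D \<and> (const_at D (t, i), const_at D (t', j)) \<in> E"
      proof (rule links_merge[OF l(1) E V ans])
        fix c c' assume *: "(t, i) \<in> Positions D" "(t', j) \<in> Positions D"
          "(const_at D (t, i), c) \<in> E" "(const_at D (t', j), c') \<in> E" "(c, c') \<in> P D (merge D E V)"
        then have "(c, c') \<in> E \<or> c = c'" using l(2) by blast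
        then have "(const_at D (t, i), c') \<in> E" using *(3) tr by blast
        then show ?thesis using *(1,2,4) tr sy by blast
      qed
      then show ?thesis unfolding merge_def pos_rel_def by blast
    qed
    consider "VRule q x i y j \<in> hard_v \<Sigma>"
      | r where "r \<in> hard_o \<Sigma>" "VRule q x i y j = T r" | "VRule q x i y j \<in> I"
      using r unfolding hard_v by blast
    then have "((t, i), (t', j)) \<in> merge D E V"
    proof cases
      case 1
      then have "((t, i), (t', j)) \<in> V"
        using h ans answers_merge[OF db E V] unfolding hard_sat_def by blast
      then show ?thesis by (simp add: merge_def)
    next
      case 2
      obtain qo xo yo where r: "r = ORule qo xo yo" by (cases r)
      have "orule_links sim S (ORule qo xo yo) (VRule q x i y j)" using T[of r] 2 r by simp
      then obtain R i0 R' j0 where l: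
        "links sim S (VRule q x i y j) R i0 R' j0 (\<lambda>D W. answers sim (valued S) D {} W qo xo yo)"
        unfolding orule_links.simps by (elim exE conjE) (rule that)
      have "answers sim (valued S) D {} (merge D E V) qo xo yo \<subseteq> E"
        using h 2(1) r answers_merge[OF db E V] unfolding hard_sat_def by blast
      then show ?thesis using linked[OF l] by blast
    next
      case 3
      then show ?thesis using I linked by blast
    qed
    then show "case p of (t, t') \<Rightarrow> ((t, i), (t', j)) \<in> merge D E V" using p by simp
  next
    fix q assume "q \<in> denials \<Sigma>"
    then show "\<not> sat sim (valued S) D {} (merge D E V) q"
      using h sat_merge[OF db E V] unfolding hard_sat_def by blast
  qed
qed

lemma Sol_eq: "Sol sim (valued S) D \<Sigma>' = {({}, V \<union> pos_rel D E) | E V. (E, V) \<in> Sol sim S D \<Sigma>}"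
proof -
  have Sol': "(E0, W) \<in> Sol sim (valued S) D \<Sigma>' \<longleftrightarrow>
      candidate sim (valued S) D \<Sigma>' E0 W \<and> E0 = {} \<and> hard_sat' W" for E0 W
  proof (cases "E0 = {}")
    case True
    then show ?thesis by (simp add: Sol_def hard_sat'_def no_orules denials)
  next
    case False
    then have "\<not> candidate sim (valued S) D \<Sigma>' E0 W" using candidate_sound by blast
    then show ?thesis by (simp add: Sol_def)
  qed
  have Sol: "(E, V) \<in> Sol sim S D \<Sigma> \<longleftrightarrow> candidate sim S D \<Sigma> E V \<and> hard_sat E V" for E V
    by (simp add: Sol_def hard_sat_def)
  \<comment> \<open>Being closed under the hard equality rules, \<open>W\<close> is itself an
    admissible choice for \<open>X\<close> in the minimality condition, which gives the missing
    inclusion.\<close>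
  have eq: "\<exists>E V. candidate sim S D \<Sigma> E V \<and> W = merge D E V"
    if W: "candidate sim (valued S) D \<Sigma>' E0 W" "hard_sat' W" for E0 W
  proof -
    obtain E V where EV: "equiv (Positions D) W" "candidate sim S D \<Sigma> E V" "W \<subseteq> merge D E V"
      and least: "\<And>X. equiv (Positions D) X \<Longrightarrow> W \<subseteq> X \<Longrightarrow> pos_rel D (Id_on (Objs S D)) \<subseteq> X
        \<Longrightarrow> merge D E V \<subseteq> X"
      using candidate_sound[OF W(1)] by blast
    have "pos_rel D (Id_on (Objs S D)) \<subseteq> W"
    proof (rule subrelI)
      fix p p' assume "(p, p') \<in> pos_rel D (Id_on (Objs S D))"
      then obtain q x y where q: "VRule q x (snd p) y (snd p') \<in> I"
        "(fst p, fst p') \<in> answers sim (valued S) D {} W q x y"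
        by (rule pos_rel_Id_answer[OF EV(1)])
      then have "VRule q x (snd p) y (snd p') \<in> hard_v \<Sigma>'" unfolding hard_v by blast
      then have "((fst p, snd p), (fst p', snd p')) \<in> W"
        using W(2) q(2) unfolding hard_sat'_def by blast
      then show "(p, p') \<in> W" by simp
    qed
    then have "W = merge D E V" using EV(3) least[OF EV(1) subset_refl] by blast
    then show ?thesis using EV(2) by blast
  qed
  have "(E0, W) \<in> Sol sim (valued S) D \<Sigma>' \<longleftrightarrow> (\<exists>E V. E0 = {} \<and> W = merge D E V \<and> (E, V) \<in> Sol sim S D \<Sigma>)"
    for E0 W
    unfolding Sol Sol' using eq candidate_complete candidate_equiv hard_sat_merge by metis
  then show ?thesis unfolding merge_def by auto
qed

end

theorem theorem1:
  fixes sim :: "'s \<Rightarrow> ('o, 'v, 't) const rel"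
    and S :: "'r schema"
    and \<Sigma> :: "('r, 's, 'o, 'v, 't) spec"
  assumes "infinite (UNIV :: 'o set)" and "infinite (UNIV :: 'v set)" and "infinite (UNIV :: 't set)"
    and "finite (dom S)"
    and "er_spec S \<Sigma>"
  shows "\<exists>\<Sigma>' :: ('r, 's, 'o, 'v, 't) spec.
           er_spec (valued S) \<Sigma>' \<and>
           hard_o \<Sigma>' = {} \<and> soft_o \<Sigma>' = {} \<and> denials \<Sigma>' = denials \<Sigma> \<and>
           (\<forall>D. database std_carrier S D \<longrightarrow>
              Sol sim (valued S) D \<Sigma>' = {({}, V \<union> pos_rel D E) | E V. (E, V) \<in> Sol sim S D \<Sigma>})"
proof -
  have fin: "finite (hard_o \<Sigma>)" "finite (soft_o \<Sigma>)" "finite (hard_v \<Sigma>)" "finite (soft_v \<Sigma>)" "finite (denials \<Sigma>)"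
    and wf: "\<forall>r \<in> hard_o \<Sigma> \<union> soft_o \<Sigma>. wf_orule S r" "\<forall>r \<in> hard_v \<Sigma> \<union> soft_v \<Sigma>. wf_vrule S r"
      "\<forall>q \<in> denials \<Sigma>. wf_denial S q"
    using assms(5) unfolding er_spec_def by auto
  have "\<forall>r \<in> hard_o \<Sigma> \<union> soft_o \<Sigma>. \<exists>r'. orule_links sim S r r'" using wf(1) ex_orule_links by blast
  then obtain T where T: "\<And>r. r \<in> hard_o \<Sigma> \<union> soft_o \<Sigma> \<Longrightarrow> orule_links sim S r (T r)" by metis
  \<comment> \<open>Finitely many object positions, since the schema is finite: one equality rule
    for each ordered pair of them keeps the specification finite.\<close>
  define K where "K = {(R, i). obj_pos S R i}"
  have "finite (Sigma (dom S) (\<lambda>R. {..length (the (S R))}))" using assms(4) by auto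
  then have "finite K" by (rule rev_finite_subset) (auto simp: K_def obj_pos_def)
  have "\<forall>R i R' j. \<exists>r. obj_pos S R i \<and> obj_pos S R' j \<longrightarrow> links sim S r R i R' j (\<lambda>D W. Id)"
    using ex_links_equal by metis
  then obtain J where J: "\<And>R i R' j. obj_pos S R i \<Longrightarrow> obj_pos S R' j \<Longrightarrow>
      links sim S (J R i R' j) R i R' j (\<lambda>D W. Id)"
    by metis
  define I where "I = (\<lambda>((R, i), (R', j)). J R i R' j) ` (K \<times> K)"
  define \<Sigma>' where "\<Sigma>' = \<lparr>hard_o = {}, soft_o = {}, hard_v = hard_v \<Sigma> \<union> T ` hard_o \<Sigma> \<union> I,
    soft_v = soft_v \<Sigma> \<union> T ` soft_o \<Sigma>, denials = denials \<Sigma>\<rparr>"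
  have I: "\<exists>R i R' j. links sim S r R i R' j (\<lambda>D W. Id)" if "r \<in> I" for r
    using that J unfolding I_def K_def by auto blast
  have I_all: "\<exists>r \<in> I. links sim S r R i R' j (\<lambda>D W. Id)" if "obj_pos S R i" "obj_pos S R' j" for R i R' j
    using J[OF that] that unfolding I_def K_def by force
  have "val_pos (valued S) R i" if "val_pos S R i" for R i
    using that by (auto simp: val_pos_def valued_def)
  then have "once_as_tid (valued S) q x i" if "once_as_tid S q x i" for q :: "('r, 's, 'o, 'v, 't) query" and x i
    using that unfolding once_as_tid_def by blast
  then have wf_v: "wf_vrule (valued S) r" if "wf_vrule S r" for r :: "('r, 's, 'o, 'v, 't) vrule"
    using that wf_query_valued by (cases r) auto
  have "wf_vrule (valued S) r" if "links sim S r R i R' j P" for r R i R' j P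
    using that by (rule links_E)
  moreover from this have wf_T: "wf_vrule (valued S) (T r)" if "r \<in> hard_o \<Sigma> \<union> soft_o \<Sigma>" for r
    using T[OF that] by (cases r) auto
  ultimately have "\<forall>r \<in> hard_v \<Sigma>' \<union> soft_v \<Sigma>'. wf_vrule (valued S) r"
    using wf_v wf(2) wf_T I unfolding \<Sigma>'_def by fastforce
  moreover have "\<forall>q \<in> denials \<Sigma>'. wf_denial (valued S) q"
  proof
    fix q assume "q \<in> denials \<Sigma>'"
    then have "wf_denial S q" using wf(3) by (simp add: \<Sigma>'_def)
    then show "wf_denial (valued S) q" using wf_query_valued[of S q] by (simp add: wf_denial_def)
  qed
  ultimately have spec': "er_spec (valued S) \<Sigma>'"
    using fin \<open>finite K\<close> unfolding er_spec_def by (simp add: \<Sigma>'_def I_def)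
  have "Sol sim (valued S) D \<Sigma>' = {({}, V \<union> pos_rel D E) | E V. (E, V) \<in> Sol sim S D \<Sigma>}"
    if "database std_carrier S D" for D
  proof -
    interpret simulation sim S D \<Sigma> \<Sigma>' T I
      by unfold_locales (use that assms(5) spec' T I I_all in \<open>auto simp: \<Sigma>'_def\<close>)
    show ?thesis by (rule Sol_eq)
  qed
  then show ?thesis using spec' by (intro exI[of _ \<Sigma>']) (simp add: \<Sigma>'_def)
qed

end
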